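(* Let $G$ be a non-trivial (i.e. having at least two vertices) planar graph and let $k$ be a positive integer. Then $G$ is a $D(k)$ graph if and only if $k=2$ and $G\cong K_{2,q}$ for some integer $q\ge 2$.
   Context: All graphs are finite, simple and connected. $K_{p,q}$ is the complete bipartite graph with parts of sizes $p$ and $q$. $\gamma(G)$ denotes the domination number and $\chi(G)$ the chromatic number of $G$. A (proper) coloring of $G$ with $k$ colors is a partition $C=(V_1,\dots,V_k)$ of $V(G)$ into nonempty independent sets, called color classes. A vertex $u$ dominates the color class $V_i$ if $u$ is adjacent to every vertex of $V_i$, or if $V_i=\{u\}$. A dominator coloring of $G$ is a coloring in which every vertex dominates at least one color class; the dominator chromatic number $\chi_d(G)$ is the minimum number of colors in a dominator coloring of $G$. A graph $G$ is called a $D(k)$ graph if $\gamma(G)=\chi(G)=\chi_d(G)=k$. *)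

theory Defs
  imports "HOL-Analysis.Analysis" "Graph_Theory.Kuratowski"
begin

text \<open>
  Finite simple graphs are instances of \<^locale>\<open>graph\<close>: finite, symmetric, loop-free digraphs
  without parallel arcs. An undirected edge is thus a pair of opposite arcs, and
  adjacency of \<open>u\<close> and \<open>v\<close> is \<open>u \<rightarrow>\<^bsub>G\<^esub> v\<close>.
\<close>

definition edges :: "('a, 'b) pre_digraph \<Rightarrow> 'a set set" where
  "edges G = {{u, v} | u v. u \<rightarrow>\<^bsub>G\<^esub> v}"

text \<open>
  A plane drawing, the plane being \<^typ>\<open>complex\<close>: the vertices are distinct points, every edge is
  an arc between its two endpoints, and the interior of an edge contains no vertex and no point of
  any other edge. Curves are indexed by unordered edges, so opposite arcs share their curve.
\<close>

definition plane_drawing ::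
  "('a, 'b) pre_digraph \<Rightarrow> ('a \<Rightarrow> complex) \<Rightarrow> ('a set \<Rightarrow> real \<Rightarrow> complex) \<Rightarrow> bool" where
  "plane_drawing G p c \<longleftrightarrow>
     inj_on p (verts G) \<and>
     (\<forall>e \<in> edges G. arc (c e) \<and> {pathstart (c e), pathfinish (c e)} = p ` e) \<and>
     (\<forall>e \<in> edges G. (path_image (c e) - p ` e) \<inter> p ` verts G = {}) \<and>
     (\<forall>e \<in> edges G. \<forall>f \<in> edges G. e \<noteq> f \<longrightarrow>
        (path_image (c e) - p ` e) \<inter> path_image (c f) = {})"

definition planar :: "('a, 'b) pre_digraph \<Rightarrow> bool" where
  "planar G \<longleftrightarrow> (\<exists>p c. plane_drawing G p c)"

definition dominating_set :: "('a, 'b) pre_digraph \<Rightarrow> 'a set \<Rightarrow> bool" where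
  "dominating_set G D \<longleftrightarrow>
     D \<subseteq> verts G \<and> (\<forall>v \<in> verts G - D. \<exists>u \<in> D. u \<rightarrow>\<^bsub>G\<^esub> v)"

definition domination_number :: "('a, 'b) pre_digraph \<Rightarrow> nat" where
  "domination_number G = (LEAST k. \<exists>D. dominating_set G D \<and> card D = k)"

definition independent_set :: "('a, 'b) pre_digraph \<Rightarrow> 'a set \<Rightarrow> bool" where
  "independent_set G S \<longleftrightarrow> S \<subseteq> verts G \<and> (\<forall>u \<in> S. \<forall>v \<in> S. \<not> u \<rightarrow>\<^bsub>G\<^esub> v)"

text \<open>
  A coloring is identified with its set of color classes, which are nonempty by
  \<^const>\<open>partition_on\<close>; the number of colors is the cardinality of that set.
\<close>

definition proper_coloring :: "('a, 'b) pre_digraph \<Rightarrow> 'a set set \<Rightarrow> bool" where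
  "proper_coloring G C \<longleftrightarrow> partition_on (verts G) C \<and> (\<forall>S \<in> C. independent_set G S)"

definition chromatic_number :: "('a, 'b) pre_digraph \<Rightarrow> nat" where
  "chromatic_number G = (LEAST k. \<exists>C. proper_coloring G C \<and> card C = k)"

definition dominates_class :: "('a, 'b) pre_digraph \<Rightarrow> 'a \<Rightarrow> 'a set \<Rightarrow> bool" where
  "dominates_class G u S \<longleftrightarrow> (\<forall>v \<in> S. u \<rightarrow>\<^bsub>G\<^esub> v) \<or> S = {u}"

definition dominator_coloring :: "('a, 'b) pre_digraph \<Rightarrow> 'a set set \<Rightarrow> bool" where
  "dominator_coloring G C \<longleftrightarrow>
     proper_coloring G C \<and> (\<forall>u \<in> verts G. \<exists>S \<in> C. dominates_class G u S)"

definition dominator_chromatic_number :: "('a, 'b) pre_digraph \<Rightarrow> nat" where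
  "dominator_chromatic_number G = (LEAST k. \<exists>C. dominator_coloring G C \<and> card C = k)"

definition D_graph :: "nat \<Rightarrow> ('a, 'b) pre_digraph \<Rightarrow> bool" where
  "D_graph k G \<longleftrightarrow>
     domination_number G = k \<and> chromatic_number G = k \<and> dominator_chromatic_number G = k"

end

theory Submission
  imports Defs
begin

text \<open>
  Take a dominator coloring with \<open>k\<close> classes, where \<open>k\<close> is also the domination number and the
  chromatic number. A set that contains one vertex of every class but \<open>S\<close> is too small to be
  dominating, and a vertex that it misses dominates \<open>S\<close> and no other class. Choosing the
  representatives among such vertices shows that some other class \<open>g S\<close> contains two vertices
  that dominate \<open>S\<close> only. The map \<open>g\<close> on classes has cycles. Let \<open>k \<ge> 3\<close>. A cycle of length at
  least three gives a minor \<open>K\<^sub>3\<^sub>,\<^sub>3\<close>. So does a cycle of length two whose classes both have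
  more than two elements: if the required connecting path did not exist, two classes could be
  merged to color \<open>G\<close> with fewer colors. If a class has two elements and they are all the vertices
  that dominate only \<open>S\<close>, then there is a dominating set or a coloring of size \<open>k - 1\<close>; this
  excludes the remaining cycles of length two, up to the case where all classes are matched in
  pairs of two-element classes, and then that case too. So \<open>k = 2\<close>, where \<open>G\<close> is complete
  bipartite without \<open>K\<^sub>3\<^sub>,\<^sub>3\<close>.

  The only minors needed are those where a single vertex of \<open>K\<^sub>3\<^sub>,\<^sub>3\<close> is replaced by a connected
  set. They are excluded by the Jordan curve theorem: no component of the complement of a theta
  curve has points of all three open arcs in its closure.
\<close>

subsection \<open>Theta curves in the plane\<close>

lemma notin_inside: "x \<in> S \<Longrightarrow> x \<notin> inside S"
  using inside_no_overlap by fastforce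

lemma connected_subset_inside:
  fixes S X :: "complex set"
  assumes "topological_space_class.connected X" and "X \<inter> S = {}" and "X \<inter> inside S \<noteq> {}"
  shows "X \<subseteq> inside S"
proof
  fix y assume "y \<in> X"
  obtain x where "x \<in> X" "x \<in> inside S"
    using assms(3) by blast
  then have "connected_component (- S) x y"
    using assms \<open>y \<in> X\<close> by (auto simp: connected_component_def)
  then show "y \<in> inside S"
    using \<open>x \<in> inside S\<close> inside_same_component by blast
qed

text \<open>A limit point of \<open>X\<close> can be added to \<open>X\<close> without losing
  connectedness, and it is then shared with \<open>Y\<close>. In the uses, \<open>Y\<close> is an
  open arc that \<open>X\<close> approaches without meeting it.\<close>

lemma connected_Un_closure_meets:
  fixes X Y :: "complex set"
  assumes "topological_space_class.connected X" and "topological_space_class.connected Y"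
    and "closure X \<inter> Y \<noteq> {}"
  shows "topological_space_class.connected (X \<union> Y)"
proof -
  obtain y where y: "y \<in> closure X" "y \<in> Y"
    using assms(3) by blast
  have "topological_space_class.connected (insert y X)"
    using y closure_subset
    by (intro connected_intermediate_closure[OF assms(1)]) auto
  then have "topological_space_class.connected (insert y X \<union> Y)"
    using y assms(2) by (intro connected_Un) auto
  then show ?thesis
    using y by (simp add: insert_absorb)
qed

text \<open>Two such arcs form a Jordan curve; three that are pairwise joined form a theta
  curve.\<close>

definition joined_arcs :: "(real \<Rightarrow> complex) \<Rightarrow> (real \<Rightarrow> complex) \<Rightarrow> complex \<Rightarrow> complex \<Rightarrow> bool" where
  "joined_arcs P Q a b \<longleftrightarrow> arc P \<and> pathstart P = a \<and> pathfinish P = b \<and>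
     arc Q \<and> pathstart Q = a \<and> pathfinish Q = b \<and> path_image P \<inter> path_image Q = {a, b}"

lemma joined_arcs_sym: "joined_arcs P Q a b \<Longrightarrow> joined_arcs Q P a b"
  by (auto simp: joined_arcs_def)

lemma joined_arcs_Int: "joined_arcs P Q a b \<Longrightarrow> path_image P \<inter> path_image Q = {a, b}"
  by (simp add: joined_arcs_def)

lemma joined_arcs_Jordan:
  assumes "joined_arcs P Q a b"
  defines "J \<equiv> path_image P \<union> path_image Q"
  shows "inside J \<noteq> {}" "topological_space_class.connected (inside J)"
    "topological_space_class.connected (outside J)" "frontier (inside J) = J" "closed J" "compact J"
proof -
  define c where "c = P +++ reversepath Q"
  have "simple_path c" "pathfinish c = pathstart c"
    using assms by (auto simp: c_def joined_arcs_def simple_path_join_loop_eq arc_reversepath)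
  moreover have "path_image c = J"
    using assms by (auto simp: c_def J_def joined_arcs_def path_image_join)
  ultimately show "inside J \<noteq> {}" "topological_space_class.connected (inside J)"
    "topological_space_class.connected (outside J)" "frontier (inside J) = J"
    using Jordan_inside_outside[of c] by auto
  show "compact J"
    using assms by (auto simp: J_def joined_arcs_def arc_imp_path intro!: compact_Un compact_path_image)
  then show "closed J" by (rule compact_imp_closed)
qed

lemma joined_arcs_interior:
  assumes "joined_arcs P Q a b"
  shows "topological_space_class.connected (path_image P - {a, b})" "path_image P - {a, b} \<noteq> {}"
    "a \<noteq> b" "a \<in> path_image P" "b \<in> path_image P" "topological_space_class.connected (path_image P)"
proof -
  have P: "arc P" "pathstart P = a" "pathfinish P = b"
    using assms by (auto simp: joined_arcs_def)
  then show "topological_space_class.connected (path_image P - {a, b})" "path_image P - {a, b} \<noteq> {}"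
    using connected_simple_path_endless[of P] nonempty_simple_path_endless[of P]
    by (simp_all add: arc_imp_simple_path)
  show "a \<noteq> b"
    using P arc_distinct_ends by blast
  show "a \<in> path_image P" "b \<in> path_image P"
    using P by (metis pathstart_in_path_image, metis pathfinish_in_path_image)
  show "topological_space_class.connected (path_image P)"
    using P(1) by (intro connected_path_image arc_imp_path)
qed

context
  fixes P Q R :: "real \<Rightarrow> complex" and a b :: complex
  assumes PQ: "joined_arcs P Q a b" and PR: "joined_arcs P R a b" and QR: "joined_arcs Q R a b"
begin

text \<open>The chord \<open>R\<close> splits the inside of the closed curve of \<open>P\<close> and
  \<open>Q\<close> into two regions. If \<open>T\<close> lay in the region bounded by
  \<open>R\<close> and one of \<open>P\<close>, \<open>Q\<close>, the other of these arcs, touched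
  by \<open>T\<close>, would be pulled inside as well, although it belongs to the curve.\<close>

lemma theta_inside:
  assumes T: "topological_space_class.connected T" "T \<inter> (path_image P \<union> path_image Q \<union> path_image R) = {}"
    and touch: "closure T \<inter> (path_image P - {a, b}) \<noteq> {}" "closure T \<inter> (path_image Q - {a, b}) \<noteq> {}"
    and T_in: "T \<inter> inside (path_image P \<union> path_image Q) \<noteq> {}"
    and R_in: "path_image R \<inter> inside (path_image P \<union> path_image Q) \<noteq> {}"
  shows False
proof -
  note Int = joined_arcs_Int[OF PQ] joined_arcs_Int[OF PR] joined_arcs_Int[OF QR]
  note sides = joined_arcs_interior[OF PQ] joined_arcs_interior[OF QR]
  have split: "inside (path_image P \<union> path_image R) \<union> inside (path_image Q \<union> path_image R) \<union>
      (path_image R - {a, b}) = inside (path_image P \<union> path_image Q)"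
  proof (rule split_inside_simple_closed_curve[of P a b Q R])
    show "simple_path P" "simple_path Q" "simple_path R"
      "pathstart P = a" "pathfinish P = b" "pathstart Q = a" "pathfinish Q = b" "pathstart R = a" "pathfinish R = b"
      using PQ PR by (simp_all add: joined_arcs_def arc_imp_simple_path)
    show "a \<noteq> b"
      by (rule joined_arcs_interior(3)[OF PQ])
  qed (use Int R_in in blast)+
  have T_out: "T \<inter> inside (path_image X \<union> path_image R) = {}"
    if "(X = P \<and> Y = Q) \<or> (X = Q \<and> Y = P)" for X Y
  proof (rule ccontr)
    assume meet: "T \<inter> inside (path_image X \<union> path_image R) \<noteq> {}"
    have "topological_space_class.connected (T \<union> (path_image Y - {a, b}))"
      using that T(1) touch sides by (intro connected_Un_closure_meets) auto
    moreover have "(T \<union> (path_image Y - {a, b})) \<inter> (path_image X \<union> path_image R) = {}"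
      using that T(2) Int by blast
    ultimately have "T \<union> (path_image Y - {a, b}) \<subseteq> inside (path_image X \<union> path_image R)"
      using meet by (intro connected_subset_inside) auto
    then have "path_image Y - {a, b} \<subseteq> inside (path_image P \<union> path_image Q)"
      using split that by auto
    moreover have "path_image Y - {a, b} \<noteq> {}"
      using that sides by auto
    ultimately show False
      using that notin_inside[of _ "path_image P \<union> path_image Q"] by auto
  qed
  show False
    using T_out[of P Q] T_out[of Q P] T_in T(2) split by auto
qed

text \<open>Each inside is connected and misses the other curve, so if they met, each would contain
  the other. Equal insides have equal frontiers, but the open arc of \<open>Q\<close> lies on only
  one of the two curves.\<close>

lemma theta_inside_disjoint:
  assumes "path_image R \<inter> inside (path_image P \<union> path_image Q) = {}"
    and "path_image Q \<inter> inside (path_image P \<union> path_image R) = {}"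
  shows "inside (path_image P \<union> path_image Q) \<inter> inside (path_image P \<union> path_image R) = {}"
proof (rule ccontr)
  assume meet: "inside (path_image P \<union> path_image Q) \<inter> inside (path_image P \<union> path_image R) \<noteq> {}"
  have "inside (path_image P \<union> path_image Q) \<inter> (path_image P \<union> path_image R) = {}"
    using assms(1) notin_inside[of _ "path_image P \<union> path_image Q"] by blast
  then have "inside (path_image P \<union> path_image Q) \<subseteq> inside (path_image P \<union> path_image R)"
    using meet joined_arcs_Jordan(2)[OF PQ] by (intro connected_subset_inside)
  moreover have "inside (path_image P \<union> path_image R) \<inter> (path_image P \<union> path_image Q) = {}"
    using assms(2) notin_inside[of _ "path_image P \<union> path_image R"] by blast
  then have "inside (path_image P \<union> path_image R) \<subseteq> inside (path_image P \<union> path_image Q)"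
    using meet joined_arcs_Jordan(2)[OF PR] by (intro connected_subset_inside) (simp_all add: Int_commute)
  ultimately have "inside (path_image P \<union> path_image Q) = inside (path_image P \<union> path_image R)"
    by (rule equalityI)
  then have "path_image P \<union> path_image Q = path_image P \<union> path_image R"
    using joined_arcs_Jordan(4)[OF PQ] joined_arcs_Jordan(4)[OF PR] by metis
  then show False
    using joined_arcs_Int[OF PQ] joined_arcs_Int[OF QR] joined_arcs_interior(2)[OF QR] by blast
qed

end

lemma connected_component_outside:
  assumes "joined_arcs P Q a b" and "x \<notin> path_image P \<union> path_image Q" "y \<notin> path_image P \<union> path_image Q"
    and "x \<notin> inside (path_image P \<union> path_image Q)" "y \<notin> inside (path_image P \<union> path_image Q)"
  shows "connected_component (- (path_image P \<union> path_image Q)) x y"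
proof -
  have "x \<in> outside (path_image P \<union> path_image Q)" "y \<in> outside (path_image P \<union> path_image Q)"
    using assms(2-5) by (simp_all add: outside_inside)
  moreover have "outside (path_image P \<union> path_image Q) \<subseteq> - (path_image P \<union> path_image Q)"
    by (auto simp add: outside_inside)
  ultimately show ?thesis
    using joined_arcs_Jordan(3)[OF assms(1)] unfolding connected_component_def by blast
qed

text \<open>By Janiszewski's theorem, the union of the two closed curves through \<open>R\<close> does not separate a
  point inside the third closed curve from a point outside all of them.\<close>

lemma theta_all_outside:
  assumes PQ: "joined_arcs P Q a b" and PR: "joined_arcs P R a b" and QR: "joined_arcs Q R a b"
    and R: "path_image R \<inter> inside (path_image P \<union> path_image Q) = {}"
    and Q: "path_image Q \<inter> inside (path_image P \<union> path_image R) = {}"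
    and P: "path_image P \<inter> inside (path_image Q \<union> path_image R) = {}"
    and t: "t \<notin> path_image P \<union> path_image Q \<union> path_image R"
      "t \<notin> inside (path_image P \<union> path_image Q)" "t \<notin> inside (path_image P \<union> path_image R)"
      "t \<notin> inside (path_image Q \<union> path_image R)"
  shows False
proof -
  obtain x where x: "x \<in> inside (path_image P \<union> path_image Q)"
    using joined_arcs_Jordan(1)[OF PQ] by blast
  have x_off: "x \<notin> path_image P \<union> path_image Q \<union> path_image R"
    using x R notin_inside[of _ "path_image P \<union> path_image Q"] by blast
  have "x \<notin> inside (path_image P \<union> path_image R)"
    using theta_inside_disjoint[OF PQ PR QR R Q] x by blast
  then have 1: "connected_component (- (path_image P \<union> path_image R)) x t"
    using x_off t by (intro connected_component_outside[OF PR]) auto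
  have "x \<notin> inside (path_image Q \<union> path_image R)"
    using theta_inside_disjoint[OF joined_arcs_sym[OF PQ] QR PR] R P x by (simp add: Un_commute) blast
  then have 2: "connected_component (- (path_image Q \<union> path_image R)) x t"
    using x_off t by (intro connected_component_outside[OF QR]) auto
  \<comment> \<open>Janiszewski's theorem asks for two sets with connected intersection; here the
    intersection is the arc \<open>R\<close>.\<close>
  have "(path_image P \<union> path_image R) \<inter> (path_image Q \<union> path_image R) = path_image R"
    using joined_arcs_Int[OF PQ] joined_arcs_interior(4,5)[OF joined_arcs_sym[OF QR]]
    by (simp add: insert_absorb flip: Un_Int_distrib2)
  then have "connected_component (- ((path_image P \<union> path_image R) \<union> (path_image Q \<union> path_image R))) x t"
    using joined_arcs_Jordan[OF PR] joined_arcs_Jordan[OF QR] joined_arcs_interior[OF joined_arcs_sym[OF QR]]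
    by (intro Janiszewski[OF _ _ _ 1 2]) simp_all
  then have "connected_component (- (path_image P \<union> path_image Q)) x t"
    by (rule connected_component_of_subset) auto
  then show False
    using inside_same_component x t(2) by blast
qed

text \<open>If one arc runs inside the closed curve of the other two, \<open>T\<close> is there too
  and \<open>theta_inside\<close> applies. Otherwise \<open>T\<close> is outside all three closed
  curves, against \<open>theta_all_outside\<close>.\<close>

lemma theta_curve_separates:
  assumes PQ: "joined_arcs P Q a b" and PR: "joined_arcs P R a b" and QR: "joined_arcs Q R a b"
    and T: "topological_space_class.connected T" "T \<inter> (path_image P \<union> path_image Q \<union> path_image R) = {}"
    and touch: "closure T \<inter> (path_image P - {a, b}) \<noteq> {}" "closure T \<inter> (path_image Q - {a, b}) \<noteq> {}"
      "closure T \<inter> (path_image R - {a, b}) \<noteq> {}"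
  shows False
proof -
  \<comment> \<open>\<open>T\<close> together with the open third arc is connected and avoids the
    closed curve, hence lies on one side of it.\<close>
  have same_side: "T \<subseteq> inside (path_image X \<union> path_image Y) \<longleftrightarrow> path_image Z \<inter> inside (path_image X \<union> path_image Y) \<noteq> {}"
    if XYZ: "joined_arcs X Y a b" "joined_arcs X Z a b" "joined_arcs Y Z a b"
      and T': "T \<inter> (path_image X \<union> path_image Y) = {}" and touchZ: "closure T \<inter> (path_image Z - {a, b}) \<noteq> {}" for X Y Z
  proof -
    let ?Z = "path_image Z - {a, b}" and ?J = "path_image X \<union> path_image Y"
    note Z = joined_arcs_interior[OF joined_arcs_sym[OF XYZ(3)]]
    have ab: "{a, b} \<subseteq> ?J"
      using joined_arcs_interior[OF XYZ(1)] by blast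
    have J: "(T \<union> ?Z) \<inter> ?J = {}"
      using joined_arcs_Int[OF XYZ(2)] joined_arcs_Int[OF XYZ(3)] T' by blast
    moreover have "topological_space_class.connected (T \<union> ?Z)"
      using T(1) touchZ Z by (intro connected_Un_closure_meets) auto
    ultimately have "(T \<union> ?Z) \<inter> inside ?J \<noteq> {} \<Longrightarrow> T \<union> ?Z \<subseteq> inside ?J"
      by (intro connected_subset_inside) auto
    moreover have "T \<noteq> {}"
      using touchZ by auto
    moreover have "path_image Z \<inter> inside ?J = ?Z \<inter> inside ?J"
      using ab notin_inside[of _ ?J] by blast
    ultimately show ?thesis
      using Z(2) by blast
  qed
  have "T \<noteq> {}"
    using touch by auto
  then obtain t where "t \<in> T" by blast
  show False
  proof (cases "path_image R \<inter> inside (path_image P \<union> path_image Q) = {} \<and>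
      path_image Q \<inter> inside (path_image P \<union> path_image R) = {} \<and>
      path_image P \<inter> inside (path_image Q \<union> path_image R) = {}")
    case True
    have "T \<inter> inside (path_image P \<union> path_image Q) = {}"
      using True same_side[OF PQ PR QR _ touch(3)] T(2) connected_subset_inside[OF T(1), of "path_image P \<union> path_image Q"]
      by blast
    moreover have "T \<inter> inside (path_image P \<union> path_image R) = {}"
      using True same_side[OF PR PQ joined_arcs_sym[OF QR] _ touch(2)] T(2)
        connected_subset_inside[OF T(1), of "path_image P \<union> path_image R"]
      by blast
    moreover have "T \<inter> inside (path_image Q \<union> path_image R) = {}"
      using True same_side[OF QR joined_arcs_sym[OF PQ] joined_arcs_sym[OF PR] _ touch(1)] T(2)
        connected_subset_inside[OF T(1), of "path_image Q \<union> path_image R"]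
      by blast
    ultimately show False
      using theta_all_outside[OF PQ PR QR, of t] True T(2) \<open>t \<in> T\<close> by blast
  next
    case False
    then consider "path_image R \<inter> inside (path_image P \<union> path_image Q) \<noteq> {}"
      | "path_image Q \<inter> inside (path_image P \<union> path_image R) \<noteq> {}"
      | "path_image P \<inter> inside (path_image Q \<union> path_image R) \<noteq> {}"
      by blast
    then show False
    proof cases
      case 1
      then have "T \<inter> inside (path_image P \<union> path_image Q) \<noteq> {}"
        using same_side[OF PQ PR QR _ touch(3)] T(2) \<open>t \<in> T\<close> by blast
      then show False
        using theta_inside[OF PQ PR QR T touch(1,2) _ 1] by blast
    next
      case 2
      then have "T \<inter> inside (path_image P \<union> path_image R) \<noteq> {}"
        using same_side[OF PR PQ joined_arcs_sym[OF QR] _ touch(2)] T(2) \<open>t \<in> T\<close> by blast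
      then show False
        using theta_inside[OF PR PQ joined_arcs_sym[OF QR] T(1) _ touch(1,3) _ 2] T(2) by blast
    next
      case 3
      then have "T \<inter> inside (path_image Q \<union> path_image R) \<noteq> {}"
        using same_side[OF QR joined_arcs_sym[OF PQ] joined_arcs_sym[OF PR] _ touch(1)] T(2) \<open>t \<in> T\<close> by blast
      then show False
        using theta_inside[OF QR joined_arcs_sym[OF PQ] joined_arcs_sym[OF PR] T(1) _ touch(2,3) _ 3] T(2) by blast
    qed
  qed
qed

subsection \<open>Plane drawings exclude \<open>K\<^sub>3\<^sub>,\<^sub>3\<close>\<close>

text \<open>This is how a component of a complement comes to touch a vertex on its boundary: it
  contains an edge shortened at that vertex.\<close>

lemma arc_minus_pathfinish:
  fixes g :: "real \<Rightarrow> complex"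
  assumes "arc g"
  shows "topological_space_class.connected (path_image g - {pathfinish g})"
    and "pathfinish g \<in> closure (path_image g - {pathfinish g})"
proof -
  have inj: "inj_on g {0..1}" and cont: "continuous_on {0..1} g"
    using assms by (auto simp: arc_def path_def)
  have eq: "path_image g - {pathfinish g} = g ` {0..<1}"
  proof -
    have "{0..1} - {1} = {0..<1::real}"
      by auto
    then have "g ` {0..<1} = g ` {0..1} - g ` {1}"
      using inj_on_image_set_diff[OF inj, of "{0..1}" "{1}"] by auto
    then show ?thesis
      by (simp add: path_image_def pathfinish_def)
  qed
  have "continuous_on {0..<1} g"
    using cont by (rule continuous_on_subset) auto
  then show "topological_space_class.connected (path_image g - {pathfinish g})"
    unfolding eq by (rule connected_continuous_image) simp
  have "g ` closure {0..<1} \<subseteq> closure (g ` {0..<1})"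
    using cont by (intro image_closure_subset) (auto simp: closure_subset)
  then show "pathfinish g \<in> closure (path_image g - {pathfinish g})"
    unfolding eq by (auto simp: pathfinish_def)
qed

section \<open>Curves of the edges in a plane drawing\<close>

locale drawn_graph = graph G for G :: "('a, 'b) pre_digraph" +
  fixes p :: "'a \<Rightarrow> complex" and c :: "'a set \<Rightarrow> real \<Rightarrow> complex"
  assumes drawing: "plane_drawing G p c"
begin

lemma adj_sym: "u \<rightarrow>\<^bsub>G\<^esub> v \<Longrightarrow> v \<rightarrow>\<^bsub>G\<^esub> u"
  using sym_arcs by (rule arcs_ends_symmetric)

lemma edge_interior_no_vertex: "e \<in> edges G \<Longrightarrow> (path_image (c e) - p ` e) \<inter> p ` verts G = {}"
  using drawing by (simp add: plane_drawing_def)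

lemma edge_interior_disjoint:
  "e \<in> edges G \<Longrightarrow> f \<in> edges G \<Longrightarrow> e \<noteq> f \<Longrightarrow> (path_image (c e) - p ` e) \<inter> path_image (c f) = {}"
  using drawing by (simp add: plane_drawing_def)

text \<open>The curve of an unordered edge may run either way; reversing it if necessary fixes the
  direction.\<close>

lemma oriented_edge:
  assumes "u \<rightarrow>\<^bsub>G\<^esub> v"
  obtains g where "Path_Connected.arc g" "pathstart g = p u" "pathfinish g = p v" "path_image g = path_image (c {u, v})"
proof -
  have "{u, v} \<in> edges G"
    using assms by (auto simp: edges_def)
  then have c: "Path_Connected.arc (c {u, v})" "{pathstart (c {u, v}), pathfinish (c {u, v})} = {p u, p v}"
    using drawing by (auto simp: plane_drawing_def)
  then consider "pathstart (c {u, v}) = p u" "pathfinish (c {u, v}) = p v"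
    | "pathstart (c {u, v}) = p v" "pathfinish (c {u, v}) = p u"
    by (auto simp: doubleton_eq_iff)
  then show thesis
  proof cases
    case 1
    then show thesis using that c(1) by blast
  next
    case 2
    then show thesis using that[of "reversepath (c {u, v})"] c(1) by (simp add: arc_reversepath)
  qed
qed

lemma edge_vertex:
  assumes "u \<rightarrow>\<^bsub>G\<^esub> v" and "z \<in> verts G" and "p z \<in> path_image (c {u, v})"
  shows "z = u \<or> z = v"
proof -
  have e: "{u, v} \<in> edges G"
    using assms by (auto simp: edges_def)
  then have "(path_image (c {u, v}) - p ` {u, v}) \<inter> p ` verts G = {}"
    by (rule edge_interior_no_vertex)
  then have "p z \<in> p ` {u, v}"
    using assms(2,3) by blast
  moreover have "u \<in> verts G" "v \<in> verts G"
    using assms(1) adj_in_verts by auto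
  ultimately show ?thesis
    using drawing assms(2) by (auto simp: plane_drawing_def inj_on_def)
qed

text \<open>The interior of one edge misses the other edge, so a common point is an end of the
  first; a vertex on the second edge can only be one of its ends.\<close>

lemma edges_meet:
  assumes "u \<rightarrow>\<^bsub>G\<^esub> v" and "x \<rightarrow>\<^bsub>G\<^esub> y" and "{u, v} \<noteq> {x, y}"
    and "z \<in> path_image (c {u, v})" "z \<in> path_image (c {x, y})"
  shows "z \<in> p ` ({u, v} \<inter> {x, y})"
proof -
  have "{u, v} \<in> edges G" "{x, y} \<in> edges G"
    using assms by (auto simp: edges_def)
  then have "(path_image (c {u, v}) - p ` {u, v}) \<inter> path_image (c {x, y}) = {}"
    using edge_interior_disjoint assms(3) by blast
  then have "z \<in> p ` {u, v}"
    using assms(4,5) by blast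
  then obtain w where w: "w \<in> {u, v}" "z = p w"
    by blast
  then have "w \<in> {x, y}"
    using edge_vertex[OF assms(2), of w] assms(1,5) adj_in_verts by auto
  then show ?thesis
    using w by auto
qed

lemma edge_ends: "u \<rightarrow>\<^bsub>G\<^esub> v \<Longrightarrow> p u \<in> path_image (c {u, v}) \<and> p v \<in> path_image (c {u, v})"
  by (metis oriented_edge pathstart_in_path_image pathfinish_in_path_image)

lemma edge_connected: "u \<rightarrow>\<^bsub>G\<^esub> v \<Longrightarrow> topological_space_class.connected (path_image (c {u, v}))"
  by (metis oriented_edge connected_path_image arc_imp_path)

lemma two_edge_arc:
  assumes "a1 \<rightarrow>\<^bsub>G\<^esub> b" "a2 \<rightarrow>\<^bsub>G\<^esub> b" "a1 \<noteq> a2"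
  obtains g where "Path_Connected.arc g" "pathstart g = p a1" "pathfinish g = p a2"
    "path_image g = path_image (c {a1, b}) \<union> path_image (c {a2, b})"
proof -
  obtain g where g: "Path_Connected.arc g" "pathstart g = p a1" "pathfinish g = p b" "path_image g = path_image (c {a1, b})"
    using oriented_edge[OF assms(1)] .
  obtain h where h: "Path_Connected.arc h" "pathstart h = p b" "pathfinish h = p a2" "path_image h = path_image (c {a2, b})"
    using oriented_edge[OF adj_sym[OF assms(2)]] by (metis insert_commute)
  have "path_image g \<inter> path_image h \<subseteq> {p b}"
    using edges_meet[OF assms(1,2)] assms(3) g h by (fastforce simp: doubleton_eq_iff)
  then have "Path_Connected.arc (g +++ h)"
    using g h by (intro arc_join) auto
  then show thesis
    using g h by (intro that[of "g +++ h"]) (auto simp: path_image_join)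
qed

text \<open>The third vertex of one side of \<open>K\<^sub>3\<^sub>,\<^sub>3\<close> is contracted from the connected set \<open>W\<close>.\<close>

lemma no_contracted_K33:
  assumes a: "a1 \<noteq> a2" and b: "b1 \<noteq> b2" "b1 \<noteq> b3" "b2 \<noteq> b3"
    and adj: "\<And>a b. a \<in> {a1, a2} \<Longrightarrow> b \<in> {b1, b2, b3} \<Longrightarrow> a \<rightarrow>\<^bsub>G\<^esub> b"
    and W: "W \<inter> {a1, a2, b1, b2, b3} = {}" "w \<in> W"
    and conn: "\<And>u. u \<in> W \<Longrightarrow> (w, u) \<in> {(x, y). x \<in> W \<and> y \<in> W \<and> x \<rightarrow>\<^bsub>G\<^esub> y}\<^sup>*"
    and nbr: "\<And>b. b \<in> {b1, b2, b3} \<Longrightarrow> \<exists>u \<in> W. u \<rightarrow>\<^bsub>G\<^esub> b"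
  shows False
proof -
  define A where "A = {a1, a2}"
  define B where "B = {b1, b2, b3}"
  define im where "im u v = path_image (c {u, v})" for u v
  \<comment> \<open>The six edges between \<open>A\<close> and \<open>B\<close>, seen as a theta
    curve: three arcs from \<open>p a1\<close> to \<open>p a2\<close>, one through each vertex of
    \<open>B\<close>.\<close>
  define \<Theta> where "\<Theta> = (\<Union>a\<in>A. \<Union>b\<in>B. im a b)"
  have AB: "a \<rightarrow>\<^bsub>G\<^esub> b" "a \<noteq> b" if "a \<in> A" "b \<in> B" for a b
    using adj that adj_not_same unfolding A_def B_def by blast+
  have verts: "A \<union> B \<subseteq> verts G"
    using adj_in_verts(1)[OF AB(1), of _ b1] adj_in_verts(2)[OF AB(1), of a1] by (auto simp: A_def B_def)
  have inj: "inj_on p (verts G)"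
    using drawing by (simp add: plane_drawing_def)
  have "\<exists>g. Path_Connected.arc g \<and> pathstart g = p a1 \<and> pathfinish g = p a2 \<and> path_image g = im a1 b \<union> im a2 b" if "b \<in> B" for b
    using two_edge_arc[of a1 b a2] AB[OF _ that] a unfolding A_def im_def by (metis insertCI)
  then obtain P where P: "\<And>b. b \<in> B \<Longrightarrow> Path_Connected.arc (P b) \<and> pathstart (P b) = p a1 \<and> pathfinish (P b) = p a2 \<and>
      path_image (P b) = im a1 b \<union> im a2 b"
    by metis
  have joined: "joined_arcs (P b) (P b') (p a1) (p a2)" if bb: "b \<in> B" "b' \<in> B" "b \<noteq> b'" for b b'
  proof -
    have "im a b \<inter> im a' b' \<subseteq> {p a1, p a2}" if "a \<in> A" "a' \<in> A" for a a'
    proof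
      fix z assume z: "z \<in> im a b \<inter> im a' b'"
      have ne: "a \<noteq> b'" "a' \<noteq> b"
        using AB(2) that bb by auto
      then have "{a, b} \<noteq> {a', b'}"
        using bb(3) by (simp add: doubleton_eq_iff)
      then have "z \<in> p ` ({a, b} \<inter> {a', b'})"
        using z edges_meet[OF AB(1)[OF that(1) bb(1)] AB(1)[OF that(2) bb(2)]] by (simp add: im_def)
      moreover have "{a, b} \<inter> {a', b'} \<subseteq> {a}"
        using ne bb(3) by blast
      ultimately have "z = p a"
        by blast
      then show "z \<in> {p a1, p a2}"
        using that(1) by (auto simp: A_def)
    qed
    moreover have "p a \<in> im a b" if "a \<in> A" "b \<in> B" for a b
      using edge_ends[OF AB(1)[OF that]] by (simp add: im_def)
    ultimately have "(im a1 b \<union> im a2 b) \<inter> (im a1 b' \<union> im a2 b') = {p a1, p a2}"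
      using bb(1,2) by (simp add: A_def) blast
    then have "path_image (P b) \<inter> path_image (P b') = {p a1, p a2}"
      using P bb by simp
    then show ?thesis
      using P bb by (simp add: joined_arcs_def)
  qed
  \<comment> \<open>An edge from \<open>W\<close> that does not end in \<open>A\<close> meets the
    theta curve at most in a vertex of \<open>B\<close>; edges within \<open>W\<close> therefore
    avoid it.\<close>
  have off: "im u v \<inter> \<Theta> \<subseteq> p ` ({u, v} \<inter> B)" if "u \<in> W" "u \<rightarrow>\<^bsub>G\<^esub> v" "v \<notin> A" for u v
  proof
    fix z assume z: "z \<in> im u v \<inter> \<Theta>"
    then obtain a b where ab: "a \<in> A" "b \<in> B" "z \<in> im a b"
      unfolding \<Theta>_def by blast
    have u: "u \<notin> A" "u \<notin> B"
      using W that(1) unfolding A_def B_def by auto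
    then have "{u, v} \<noteq> {a, b}"
      using ab by (auto simp: doubleton_eq_iff)
    then have "z \<in> p ` ({u, v} \<inter> {a, b})"
      using z ab edges_meet[OF that(2) AB(1)[OF ab(1,2)]] by (simp add: im_def)
    moreover have "{u, v} \<inter> {a, b} \<subseteq> {u, v} \<inter> B"
      using u ab that(3) by blast
    ultimately show "z \<in> p ` ({u, v} \<inter> B)"
      by blast
  qed
  \<comment> \<open>The component of the complement that will contain all points of
    \<open>W\<close>. It takes the role of the third vertex beside \<open>a1\<close> and
    \<open>a2\<close>.\<close>
  define T where "T = connected_component_set (- \<Theta>) (p w)"
  have ab_disj: "A \<inter> B = {}"
    using AB(2) by blast
  have W_AB: "W \<inter> (A \<union> B) = {}"
    using W unfolding A_def B_def by auto
  have w_off: "p w \<notin> \<Theta>"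
  proof -
    \<comment> \<open>A neighbour of \<open>w\<close> shows that \<open>w\<close> is a vertex of
      \<open>G\<close>, so an edge through \<open>p w\<close> must end there.\<close>
    obtain v where "w \<rightarrow>\<^bsub>G\<^esub> v"
    proof (cases "W = {w}")
      case True
      then show thesis using nbr[of b1] that by auto
    next
      case False
      then obtain u where "u \<in> W" "u \<noteq> w"
        using W(2) by blast
      then show thesis
        using conn[of u] that by (auto elim: converse_rtranclE)
    qed
    then have "w \<in> verts G"
      using adj_in_verts by blast
    then have "p w \<notin> im a b" if "a \<in> A" "b \<in> B" for a b
      using edge_vertex[OF AB(1)[OF that]] that W_AB W(2) unfolding im_def by blast
    then show ?thesis
      unfolding \<Theta>_def by blast
  qed
  have pT: "p u \<in> T" if "u \<in> W" for u
    using conn[OF that]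
  proof induction
    case base
    then show ?case using w_off by (simp add: T_def)
  next
    case (step y z)
    then have yz: "y \<in> W" "z \<in> W" "y \<rightarrow>\<^bsub>G\<^esub> z"
      by auto
    then have "im y z \<subseteq> - \<Theta>"
      using off[of y z] W_AB by blast
    moreover have "topological_space_class.connected (im y z)" "p y \<in> im y z" "p z \<in> im y z"
      using edge_connected[of y z] edge_ends[of y z] yz unfolding im_def by auto
    ultimately have "connected_component (- \<Theta>) (p y) (p z)"
      by (auto simp: connected_component_def)
    then show ?case
      using step.IH unfolding T_def by (auto intro: connected_component_trans)
  qed
  \<comment> \<open>An edge from \<open>W\<close> to \<open>b\<close>, without its end at
    \<open>b\<close>, stays in \<open>T\<close>. So \<open>p b\<close> is a limit point of
    \<open>T\<close> on the open arc through \<open>b\<close>.\<close>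
  have touch: "closure T \<inter> (path_image (P b) - {p a1, p a2}) \<noteq> {}" if b: "b \<in> B" for b
  proof -
    obtain u where u: "u \<in> W" "u \<rightarrow>\<^bsub>G\<^esub> b"
      using nbr b unfolding B_def by blast
    obtain g where g: "Path_Connected.arc g" "pathstart g = p u" "pathfinish g = p b" "path_image g = im u b"
      using oriented_edge[OF u(2)] unfolding im_def .
    have ub: "u \<noteq> b"
      using u(2) adj_not_same by blast
    have "u \<in> verts G" "b \<in> verts G"
      using u adj_in_verts by auto
    then have "p u \<noteq> p b"
      using inj ub by (auto simp: inj_on_def)
    then have "p u \<in> path_image g - {p b}"
      using g(2) pathstart_in_path_image[of g] by auto
    moreover have "path_image g - {p b} \<subseteq> - \<Theta>"
      using off[of u b] u b ab_disj W_AB g(4) by blast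
    moreover have "topological_space_class.connected (path_image g - {p b})"
      using arc_minus_pathfinish(1)[OF g(1)] g(3) by simp
    ultimately have "path_image g - {p b} \<subseteq> connected_component_set (- \<Theta>) (p u)"
      by (intro connected_component_maximal)
    also have "\<dots> = T"
      using pT[OF u(1)] connected_component_eq[of "p u" "- \<Theta>" "p w"] unfolding T_def by simp
    finally have "p b \<in> closure T"
      using arc_minus_pathfinish(2)[OF g(1)] g(3) closure_mono by auto
    moreover have "p b \<in> path_image (P b)"
      using P[OF b] edge_ends[of a1 b] AB[OF _ b] unfolding A_def im_def by auto
    moreover have "p b \<noteq> p a" if "a \<in> A" for a
      using AB[OF that b] that b verts inj by (auto simp: inj_on_def)
    ultimately show ?thesis
      unfolding A_def by blast
  qed
  have "T \<inter> \<Theta> = {}"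
    using connected_component_subset[of "- \<Theta>" "p w"] unfolding T_def by blast
  moreover have "path_image (P b) \<subseteq> \<Theta>" if "b \<in> B" for b
    using P[OF that] that unfolding \<Theta>_def A_def by auto
  ultimately have "T \<inter> (path_image (P b1) \<union> path_image (P b2) \<union> path_image (P b3)) = {}"
    unfolding B_def by auto
  then show False
    using theta_curve_separates[of "P b1" "P b2" "p a1" "p a2" "P b3" T] joined touch b
    unfolding T_def B_def by simp
qed

text \<open>The case where the contracted set is the single vertex \<open>a3\<close>.\<close>

lemma no_K33:
  assumes "3 \<le> card A" "3 \<le> card B" and adj: "\<And>a b. a \<in> A \<Longrightarrow> b \<in> B \<Longrightarrow> a \<rightarrow>\<^bsub>G\<^esub> b"
  shows False
proof -
  obtain A' where "A' \<subseteq> A" "card A' = 3"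
    using assms(1) by (meson obtain_subset_with_card_n)
  then obtain a1 a2 a3 where a: "{a1, a2, a3} \<subseteq> A" "a1 \<noteq> a2" "a1 \<noteq> a3" "a2 \<noteq> a3"
    by (metis card_3_iff)
  obtain B' where "B' \<subseteq> B" "card B' = 3"
    using assms(2) by (meson obtain_subset_with_card_n)
  then obtain b1 b2 b3 where b: "{b1, b2, b3} \<subseteq> B" "b1 \<noteq> b2" "b1 \<noteq> b3" "b2 \<noteq> b3"
    by (metis card_3_iff)
  have ab: "x \<rightarrow>\<^bsub>G\<^esub> y" "x \<noteq> y" if "x \<in> {a1, a2, a3}" "y \<in> {b1, b2, b3}" for x y
    using adj[of x y] adj_not_same[of x] that a(1) b(1) by auto
  show False
  proof (rule no_contracted_K33[of a1 a2 b1 b2 b3 "{a3}" a3])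
    show "{a3} \<inter> {a1, a2, b1, b2, b3} = {}"
      using a ab(2)[of a3] by auto
    show "x \<rightarrow>\<^bsub>G\<^esub> y" if "x \<in> {a1, a2}" "y \<in> {b1, b2, b3}" for x y
      using ab(1)[of x y] that by blast
    show "\<exists>u \<in> {a3}. u \<rightarrow>\<^bsub>G\<^esub> y" if "y \<in> {b1, b2, b3}" for y
      using ab(1)[of a3 y] that by blast
  qed (use a b in auto)
qed

end

subsection \<open>Minimal dominator colorings\<close>

lemma funpow_closed: "(\<And>y. y \<in> A \<Longrightarrow> f y \<in> A) \<Longrightarrow> x \<in> A \<Longrightarrow> (f ^^ n) x \<in> A"
  by (induction n) auto

text \<open>An orbit in a finite set repeats. At a repeated point \<open>y\<close>, the least return
  time \<open>m\<close> makes the first \<open>m\<close> iterates distinct.\<close>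

lemma cycle_in_closed_set:
  fixes f :: "'a \<Rightarrow> 'a"
  assumes "finite A" and "x \<in> A" and closed: "\<And>y. y \<in> A \<Longrightarrow> f y \<in> A"
  obtains y m where "y \<in> A" "0 < m" "(f ^^ m) y = y" "inj_on (\<lambda>n. (f ^^ n) y) {..<m}"
proof -
  have orbit: "(f ^^ n) x \<in> A" for n
    using closed assms(2) by (rule funpow_closed)
  then have "\<not> inj (\<lambda>n. (f ^^ n) x)"
    using assms(1) by (meson finite_subset image_subsetI infinite_UNIV_nat finite_imageD)
  then obtain i j where "i < j" "(f ^^ i) x = (f ^^ j) x"
    by (metis injI linorder_neqE_nat)
  define y where "y = (f ^^ i) x"
  have "(f ^^ (j - i)) y = (f ^^ (j - i + i)) x"
    by (simp only: y_def funpow_add comp_apply)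
  then have "0 < j - i \<and> (f ^^ (j - i)) y = y"
    using \<open>i < j\<close> \<open>(f ^^ i) x = (f ^^ j) x\<close> by (simp add: y_def)
  then have ex: "\<exists>m. 0 < m \<and> (f ^^ m) y = y"
    by blast
  define m where "m = (LEAST m. 0 < m \<and> (f ^^ m) y = y)"
  have m: "0 < m" "(f ^^ m) y = y"
    using LeastI_ex[OF ex] by (auto simp: m_def)
  \<comment> \<open>Applying \<open>f\<close> another \<open>m - l\<close> times to both sides would
    return to \<open>y\<close> after \<open>m - l + k < m\<close> steps.\<close>
  have no_repeat: False if "k < l" "l < m" "(f ^^ k) y = (f ^^ l) y" for k l
  proof -
    have "(f ^^ (m - l + k)) y = (f ^^ (m - l)) ((f ^^ l) y)"
      using that(3) by (simp add: funpow_add)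
    also have "\<dots> = (f ^^ (m - l + l)) y"
      by (simp only: funpow_add comp_apply)
    also have "\<dots> = (f ^^ m) y"
      using that(2) by simp
    finally have "m \<le> m - l + k"
      unfolding m_def using that m by (intro Least_le) (auto simp flip: m_def)
    then show False
      using that by linarith
  qed
  have "inj_on (\<lambda>n. (f ^^ n) y) {..<m}"
    by (rule inj_onI) (metis no_repeat lessThan_iff linorder_neqE_nat)
  then show thesis
    using that m orbit unfolding y_def by blast
qed

text \<open>The domination number and the chromatic number of a D(k) graph enter as minimality of
  \<open>card C\<close> among dominating sets and proper colorings; \<open>has_neighbour\<close>
  stands for connectedness with at least two vertices.\<close>

locale D_coloring = drawn_graph +
  fixes C :: "'a set set"
  assumes coloring: "dominator_coloring G C"
    and domination_min: "\<And>D. dominating_set G D \<Longrightarrow> card C \<le> card D"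
    and coloring_min: "\<And>C'. proper_coloring G C' \<Longrightarrow> card C \<le> card C'"
    and has_neighbour: "\<And>v. v \<in> verts G \<Longrightarrow> \<exists>u. v \<rightarrow>\<^bsub>G\<^esub> u"
begin

lemma partition: "partition_on (verts G) C"
  using coloring by (simp add: dominator_coloring_def proper_coloring_def)

lemma class_nonempty: "S \<in> C \<Longrightarrow> S \<noteq> {}"
  using partition by (auto simp: partition_on_def)

lemma class_verts: "S \<in> C \<Longrightarrow> v \<in> S \<Longrightarrow> v \<in> verts G"
  using partition by (auto simp: partition_on_def)

lemma class_exists: "v \<in> verts G \<Longrightarrow> \<exists>S \<in> C. v \<in> S"
  using partition by (auto simp: partition_on_def)

lemma class_unique: "S \<in> C \<Longrightarrow> T \<in> C \<Longrightarrow> v \<in> S \<Longrightarrow> v \<in> T \<Longrightarrow> S = T"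
  using partition by (auto simp: partition_on_def disjoint_def)

lemma class_independent: "S \<in> C \<Longrightarrow> u \<in> S \<Longrightarrow> v \<in> S \<Longrightarrow> \<not> u \<rightarrow>\<^bsub>G\<^esub> v"
  using coloring by (auto simp: dominator_coloring_def proper_coloring_def independent_set_def)

lemma finite_class: "S \<in> C \<Longrightarrow> finite S"
  using class_verts finite_verts by (meson finite_subset subsetI)

lemma finite_C: "finite C"
  using partition finite_verts by (rule finite_elements[rotated])

lemma dominates_some: "v \<in> verts G \<Longrightarrow> \<exists>S \<in> C. dominates_class G v S"
  using coloring by (auto simp: dominator_coloring_def)

lemma dominates_adj: "dominates_class G w S \<Longrightarrow> w \<notin> S \<Longrightarrow> v \<in> S \<Longrightarrow> w \<rightarrow>\<^bsub>G\<^esub> v"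
  by (auto simp: dominates_class_def)

lemma dominates_own: "dominates_class G w S \<Longrightarrow> w \<in> S \<Longrightarrow> S = {w}"
  using adj_not_same by (auto simp: dominates_class_def)

text \<open>The counterpart of a private neighbourhood: a vertex left undominated by representatives
  of all classes but \<open>S\<close> lies here.\<close>

definition only :: "'a set \<Rightarrow> 'a set" where
  "only S = {v \<in> verts G. \<forall>T \<in> C. dominates_class G v T \<longleftrightarrow> T = S}"

lemma only_dominates: "S \<in> C \<Longrightarrow> w \<in> only S \<Longrightarrow> dominates_class G w S"
  by (auto simp: only_def)

lemma only_unique: "S \<in> C \<Longrightarrow> w \<in> only S \<Longrightarrow> w \<in> only T \<Longrightarrow> S = T"
  by (auto simp: only_def)

lemma finite_only: "finite (only S)"
  by (simp add: only_def)

text \<open>The representatives \<open>x T\<close> are too few to dominate, so some \<open>w\<close>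
  is missed. If \<open>w\<close> dominated a class other than \<open>S\<close>, it would be equal or
  adjacent to the representative of that class.\<close>

lemma private_vertex:
  assumes S: "S \<in> C" and x: "\<And>T. T \<in> C \<Longrightarrow> T \<noteq> S \<Longrightarrow> x T \<in> T"
  obtains w where "w \<in> only S" "\<And>T. T \<in> C \<Longrightarrow> T \<noteq> S \<Longrightarrow> w \<noteq> x T \<and> \<not> x T \<rightarrow>\<^bsub>G\<^esub> w"
proof -
  define D where "D = x ` (C - {S})"
  have "card D \<le> card (C - {S})"
    unfolding D_def using finite_C by (intro card_image_le) auto
  also have "\<dots> < card C"
    using S finite_C by (intro psubset_card_mono) auto
  finally have "\<not> dominating_set G D"
    using domination_min[of D] by auto
  moreover have "D \<subseteq> verts G"
    unfolding D_def using x class_verts by blast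
  ultimately obtain w where w: "w \<in> verts G" "w \<notin> D" "\<And>u. u \<in> D \<Longrightarrow> \<not> u \<rightarrow>\<^bsub>G\<^esub> w"
    by (auto simp: dominating_set_def)
  have T: "T = S" if "T \<in> C" "dominates_class G w T" for T
  proof (rule ccontr)
    assume "T \<noteq> S"
    then have "x T \<in> D" "x T \<in> T"
      using that x unfolding D_def by auto
    then show False
      using that(2) w(2) w(3)[of "x T"] adj_sym[of w "x T"] by (auto simp: dominates_class_def)
  qed
  obtain T where "T \<in> C" "dominates_class G w T"
    using dominates_some w(1) by blast
  then have "w \<in> only S"
    using T w(1) S unfolding only_def by auto
  then show thesis
    using that w unfolding D_def by blast
qed

lemma only_nonempty: "S \<in> C \<Longrightarrow> only S \<noteq> {}"
  using private_vertex[of S "\<lambda>T. SOME y. y \<in> T"] class_nonempty by (metis empty_iff some_in_eq)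

text \<open>Take representatives in \<open>only S\<close> where possible. If no other class had two
  vertices of \<open>only S\<close>, the missed vertex \<open>w\<close> would lie in
  \<open>S\<close>, forcing \<open>S = {w}\<close>; but then the class of a neighbour of
  \<open>w\<close> has a representative adjacent to \<open>w\<close>.\<close>

lemma only_pair:
  assumes S: "S \<in> C"
  shows "\<exists>T \<in> C. T \<noteq> S \<and> 2 \<le> card (only S \<inter> T)"
proof (rule ccontr)
  assume none: "\<not> ?thesis"
  \<comment> \<open>Representatives are chosen in \<open>only S\<close> first and, failing that,
    adjacent to all of \<open>S\<close>. The second preference matters only when \<open>S\<close>
    turns out to be a singleton.\<close>
  have "\<exists>y. y \<in> T \<and> (only S \<inter> T \<noteq> {} \<longrightarrow> y \<in> only S) \<and>
      (only S \<inter> T = {} \<and> (\<exists>y \<in> T. \<forall>z \<in> S. z \<rightarrow>\<^bsub>G\<^esub> y) \<longrightarrow> (\<forall>z \<in> S. z \<rightarrow>\<^bsub>G\<^esub> y))" if "T \<in> C" for T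
    using class_nonempty[OF that] by blast
  then obtain x where x: "\<And>T. T \<in> C \<Longrightarrow> x T \<in> T"
    and x_only: "\<And>T. T \<in> C \<Longrightarrow> only S \<inter> T \<noteq> {} \<Longrightarrow> x T \<in> only S"
    and x_adj: "\<And>T z. T \<in> C \<Longrightarrow> only S \<inter> T = {} \<Longrightarrow> \<exists>y \<in> T. \<forall>z \<in> S. z \<rightarrow>\<^bsub>G\<^esub> y \<Longrightarrow> z \<in> S \<Longrightarrow> z \<rightarrow>\<^bsub>G\<^esub> x T"
    by metis
  obtain w where w: "w \<in> only S" "\<And>T. T \<in> C \<Longrightarrow> T \<noteq> S \<Longrightarrow> w \<noteq> x T \<and> \<not> x T \<rightarrow>\<^bsub>G\<^esub> w"
    using private_vertex[OF S, of x] x by metis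
  have "w \<in> S"
  proof (rule ccontr)
    assume "w \<notin> S"
    obtain T where T: "T \<in> C" "w \<in> T"
      using w(1) class_exists unfolding only_def by blast
    then have "T \<noteq> S" "{w, x T} \<subseteq> only S \<inter> T" "w \<noteq> x T"
      using \<open>w \<notin> S\<close> w x x_only by auto
    then have "2 \<le> card (only S \<inter> T)"
      using card_mono[of "only S \<inter> T" "{w, x T}"] finite_only by auto
    then show False
      using none T \<open>T \<noteq> S\<close> by blast
  qed
  then have S_eq: "S = {w}"
    using dominates_own only_dominates S w(1) by blast
  obtain y where y: "w \<rightarrow>\<^bsub>G\<^esub> y"
    using has_neighbour w(1) unfolding only_def by blast
  obtain T where T: "T \<in> C" "y \<in> T"
    using class_exists adj_in_verts(2)[OF y] by blast
  have "T \<noteq> S"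
    using T(2) S_eq y adj_not_same by blast
  then have "w \<notin> T"
    using class_unique T(1) S S_eq by blast
  have "x T \<rightarrow>\<^bsub>G\<^esub> w"
  proof (cases "only S \<inter> T = {}")
    case True
    then have "w \<rightarrow>\<^bsub>G\<^esub> x T"
      using x_adj[OF T(1) True] T(2) y S_eq by blast
    then show ?thesis by (rule adj_sym)
  next
    case False
    then have "dominates_class G (x T) S"
      using x_only T(1) only_dominates S by blast
    moreover have "x T \<notin> S"
      using x[OF T(1)] \<open>w \<notin> T\<close> S_eq by auto
    ultimately show ?thesis
      using dominates_adj S_eq by blast
  qed
  then show False
    using w(2) T(1) \<open>T \<noteq> S\<close> by blast
qed

text \<open>Otherwise merging the two classes would save a color.\<close>

lemma classes_adjacent:
  assumes S: "S \<in> C" and T: "T \<in> C" and "S \<noteq> T"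
  shows "\<exists>u \<in> S. \<exists>v \<in> T. u \<rightarrow>\<^bsub>G\<^esub> v"
proof (rule ccontr)
  assume none: "\<not> ?thesis"
  define C' where "C' = insert (S \<union> T) (C - {S, T})"
  have "independent_set G (S \<union> T)"
    using none class_independent[OF S] class_independent[OF T] class_verts[OF S] class_verts[OF T] adj_sym
    unfolding independent_set_def by blast
  then have "\<forall>U \<in> C'. independent_set G U"
    using coloring unfolding C'_def dominator_coloring_def proper_coloring_def by blast
  moreover have "partition_on (verts G) C'"
  proof (rule partition_onI)
    show "\<Union> C' = verts G"
      using partition S T unfolding C'_def partition_on_def by blast
    show "{} \<notin> C'"
      using class_nonempty S unfolding C'_def by blast
    show "disjnt U V" if "U \<in> C'" "V \<in> C'" "U \<noteq> V" for U V
      using that class_unique S T unfolding C'_def disjnt_def by blast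
  qed
  ultimately have "card C \<le> card C'"
    using coloring_min by (simp add: proper_coloring_def)
  also have "\<dots> \<le> Suc (card (C - {S, T}))"
    unfolding C'_def using finite_C by (simp add: card_insert_if)
  also have "card (C - {S, T}) = card C - 2"
    using S T \<open>S \<noteq> T\<close> finite_C by (simp add: card_Diff_subset)
  \<comment> \<open>The inequality is \<open>card C \<le> Suc (card C - 2)\<close>; as subtraction
    stops at 0, it leaves the values below 2, which two distinct classes exclude.\<close>
  finally have "card C < 2"
    by linarith
  moreover have "card {S, T} \<le> card C"
    using S T finite_C by (intro card_mono) auto
  ultimately show False
    using \<open>S \<noteq> T\<close> by simp
qed

lemma third_class:
  assumes "3 \<le> card C"
  obtains U where "U \<in> C" "U \<noteq> S" "U \<noteq> T"
proof -
  have "\<not> C \<subseteq> {S, T}"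
  proof
    assume "C \<subseteq> {S, T}"
    then have "card C \<le> card {S, T}"
      by (intro card_mono) auto
    also have "\<dots> \<le> 2"
      by (simp add: card_insert_if)
    finally show False
      using assms by simp
  qed
  then show thesis
    using that by blast
qed

text \<open>Some \<open>b\<close> in \<open>T\<close> has a neighbour \<open>y\<close> in a third
  class. Represent \<open>T\<close> by its other element \<open>b'\<close> and the third class by
  \<open>y\<close>: then both elements of \<open>only S\<close> are dominated, and
  \<open>private_vertex\<close> has none left to give.\<close>

lemma only_not_pair_class:
  assumes "3 \<le> card C" and S: "S \<in> C" and T: "T \<in> C" and "S \<noteq> T" and only: "only S = T" and "card T = 2"
  shows False
proof -
  obtain U where U: "U \<in> C" "U \<noteq> S" "U \<noteq> T"
    using third_class[OF assms(1)] .
  then obtain b y where by': "b \<in> T" "y \<in> U" "b \<rightarrow>\<^bsub>G\<^esub> y"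
    using classes_adjacent[OF T U(1)] by blast
  obtain b' where b': "T = {b, b'}"
    using \<open>card T = 2\<close> by'(1) by (auto simp: card_2_iff)
  define x where "x V = (if V = T then b' else if V = U then y else SOME v. v \<in> V)" for V
  have x: "x V \<in> V" if "V \<in> C" for V
    using class_nonempty[OF that] by' b' unfolding x_def by (auto simp: some_in_eq)
  obtain w where w: "w \<in> only S" "\<And>V. V \<in> C \<Longrightarrow> V \<noteq> S \<Longrightarrow> w \<noteq> x V \<and> \<not> x V \<rightarrow>\<^bsub>G\<^esub> w"
    using private_vertex[OF S, of x] x by metis
  have "w \<noteq> b'"
    using w(2)[OF T] \<open>S \<noteq> T\<close> by (auto simp: x_def)
  then have "w = b"
    using w(1) only b' by auto
  then show False
    using w(2)[OF U(1,2)] U(3) adj_sym[OF by'(3)] by (simp add: x_def)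
qed

text \<open>If \<open>S\<close> had three elements, all of \<open>only S\<close> would lie outside
  \<open>S\<close> and be adjacent to all of it. A vertex of \<open>only S\<close> beyond the two in
  \<open>T\<close> would give K_{3,3}, so \<open>only S = T\<close>, which is excluded.\<close>

lemma mutual_pairs_small_side:
  assumes k: "3 \<le> card C" and S: "S \<in> C" and T: "T \<in> C" and "S \<noteq> T"
    and bb: "2 \<le> card (only S \<inter> T)" and "card T = 2"
  shows "card S < 3"
proof (rule ccontr)
  assume large: "\<not> ?thesis"
  have T_only: "T \<subseteq> only S"
    using bb \<open>card T = 2\<close> finite_class[OF T] by (metis card_seteq inf_le2 inf_le1)
  have "only S \<subseteq> T"
  proof
    fix w assume w: "w \<in> only S"
    show "w \<in> T"
    proof (rule ccontr)
      assume "w \<notin> T"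
      have notin: "z \<notin> S" if "z \<in> only S" for z
      proof
        assume "z \<in> S"
        then have "S = {z}"
          using that only_dominates S dominates_own by blast
        then show False
          using large by simp
      qed
      have "3 \<le> card (insert w T)"
        using \<open>w \<notin> T\<close> \<open>card T = 2\<close> finite_class[OF T] by simp
      moreover have "z \<rightarrow>\<^bsub>G\<^esub> v" if "z \<in> insert w T" "v \<in> S" for z v
        using that notin dominates_adj only_dominates[OF S] T_only w by blast
      ultimately show False
        using no_K33[of "insert w T" S] large by (simp add: not_less)
    qed
  qed
  then show False
    using only_not_pair_class[OF k S T \<open>S \<noteq> T\<close> _ \<open>card T = 2\<close>] T_only by blast
qed

lemma mutual_pairs_not_both_large:
  assumes k: "3 \<le> card C" and S: "S \<in> C" and T: "T \<in> C" and "S \<noteq> T"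
    and "2 \<le> card (only S \<inter> T)" and "2 \<le> card (only T \<inter> S)"
    and large: "3 \<le> card S" "3 \<le> card T"
  shows False
proof -
  obtain b b' where b: "b \<noteq> b'" "b \<in> only S" "b \<in> T" "b' \<in> only S" "b' \<in> T"
    using \<open>2 \<le> card (only S \<inter> T)\<close> by (auto simp: card_le_Suc_iff numeral_2_eq_2)
  obtain c c' where c: "c \<noteq> c'" "c \<in> only T" "c \<in> S" "c' \<in> only T" "c' \<in> S"
    using \<open>2 \<le> card (only T \<inter> S)\<close> by (auto simp: card_le_Suc_iff numeral_2_eq_2)
  have disj: "v \<notin> S" if "v \<in> T" for v
    using class_unique S T that \<open>S \<noteq> T\<close> by blast
  have b_adj: "b \<rightarrow>\<^bsub>G\<^esub> v" "b' \<rightarrow>\<^bsub>G\<^esub> v" if "v \<in> S" for v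
    using that b disj dominates_adj only_dominates[OF S] by blast+
  have c_adj: "c \<rightarrow>\<^bsub>G\<^esub> v" "c' \<rightarrow>\<^bsub>G\<^esub> v" if "v \<in> T" for v
    using that c disj dominates_adj only_dominates[OF T] by blast+
  have K33_S: False if "v \<in> T" "v \<notin> {b, b'}" "dominates_class G v S" for v
  proof -
    have "3 \<le> card {b, b', v}"
      using that b(1) by auto
    moreover have "z \<rightarrow>\<^bsub>G\<^esub> s" if "z \<in> {b, b', v}" "s \<in> S" for z s
      using that b_adj dominates_adj disj \<open>v \<in> T\<close> \<open>dominates_class G v S\<close> by blast
    ultimately show False
      using no_K33 large(1) by blast
  qed
  have K33_T: False if "v \<in> S" "v \<notin> {c, c'}" "dominates_class G v T" for v
  proof -
    have "3 \<le> card {c, c', v}"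
      using that c(1) by auto
    moreover have "z \<rightarrow>\<^bsub>G\<^esub> s" if "z \<in> {c, c', v}" "s \<in> T" for z s
      using that c_adj dominates_adj disj \<open>v \<in> S\<close> \<open>dominates_class G v T\<close> by blast
    ultimately show False
      using no_K33 large(2) by blast
  qed
  have not_own: "\<not> dominates_class G v V" if "V \<in> C" "v \<in> V" "3 \<le> card V" for v V
  proof
    assume "dominates_class G v V"
    then have "V = {v}"
      using that dominates_own by blast
    then show False
      using that(3) by simp
  qed
  have "\<not> S \<subseteq> {c, c'}"
    using large(1) card_mono[of "{c, c'}" S] c(1) by auto
  then obtain u where u: "u \<in> S" "u \<notin> {c, c'}"
    by blast
  \<comment> \<open>Deleting \<open>c\<close>, \<open>c'\<close> and all of \<open>T\<close> leaves
    the part of the graph in which a third partner for \<open>c\<close> and \<open>c'\<close> can be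
    grown from \<open>u\<close>.\<close>
  define X where "X = {c, c'} \<union> T"
  define E where "E = {(x, y). x \<notin> X \<and> y \<notin> X \<and> x \<rightarrow>\<^bsub>G\<^esub> y}"
  \<comment> \<open>If \<open>v \<in> T - {b, b'}\<close> has a neighbour in \<open>R\<close>, then contracting \<open>R\<close> yields \<open>K\<^sub>3\<^sub>,\<^sub>3\<close> with
    parts \<open>{c, c', R}\<close> and \<open>{b, b', v}\<close>. Otherwise every further class lies inside or outside \<open>R\<close>,
    and two classes on different sides could be merged.\<close>
  define R where "R = {x. (u, x) \<in> E\<^sup>*}"
  have u_X: "u \<notin> X"
    using u disj unfolding X_def by blast
  have R_X: "x \<notin> X" if "x \<in> R" for x
    using that u_X unfolding R_def E_def by (auto elim: rtranclE)
  have u_R: "u \<in> R"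
    by (simp add: R_def)
  have R_step: "y \<in> R" if "x \<in> R" "y \<notin> X" "x \<rightarrow>\<^bsub>G\<^esub> y \<or> y \<rightarrow>\<^bsub>G\<^esub> x" for x y
  proof -
    have "(x, y) \<in> E"
      using that R_X adj_sym unfolding E_def by blast
    then show ?thesis
      using that(1) unfolding R_def by (auto intro: rtrancl_into_rtrancl)
  qed
  have R_conn: "(u, x) \<in> {(x, y). x \<in> R \<and> y \<in> R \<and> x \<rightarrow>\<^bsub>G\<^esub> y}\<^sup>*" if "x \<in> R" for x
  proof -
    have "(u, x) \<in> E\<^sup>*"
      using that by (simp add: R_def)
    then show ?thesis
    proof induction
      case (step y z)
      then have "y \<in> R" "z \<in> R" "y \<rightarrow>\<^bsub>G\<^esub> z"
        unfolding R_def E_def by (auto intro: rtrancl_into_rtrancl)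
      then show ?case
        using step.IH by (auto intro: rtrancl_into_rtrancl)
    qed simp
  qed
  have far: "\<not> y \<rightarrow>\<^bsub>G\<^esub> v" if v: "v \<in> T" "v \<notin> {b, b'}" and "y \<in> R" for v y
  proof
    assume "y \<rightarrow>\<^bsub>G\<^esub> v"
    show False
    proof (rule no_contracted_K33[of c c' b b' v R u])
      show "R \<inter> {c, c', b, b', v} = {}"
        using R_X b v unfolding X_def by blast
      show "\<exists>z \<in> R. z \<rightarrow>\<^bsub>G\<^esub> x" if "x \<in> {b, b', v}" for x
        using that \<open>y \<in> R\<close> \<open>y \<rightarrow>\<^bsub>G\<^esub> v\<close> u_R b_adj[OF u(1)] adj_sym by blast
    qed (use b c v u_R R_conn c_adj in auto)
  qed
  have class_X: "z \<notin> X" if "V \<in> C" "V \<noteq> S" "V \<noteq> T" "z \<in> V" for V z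
    using that class_unique S T c unfolding X_def by blast
  \<comment> \<open>A vertex \<open>w\<close> of \<open>only V\<close> outside \<open>V\<close> is
    adjacent to all of \<open>V\<close>. If \<open>w\<close> is in \<open>T\<close>, then
    \<open>far\<close> keeps \<open>V\<close> off \<open>R\<close>; otherwise \<open>w\<close>
    avoids \<open>X\<close> and links all of \<open>V\<close>.\<close>
  have inside_or_outside: "V \<subseteq> R \<or> V \<inter> R = {}" if V: "V \<in> C" "V \<noteq> S" "V \<noteq> T" for V
  proof -
    obtain w where w: "w \<in> only V"
      using only_nonempty[OF V(1)] by blast
    then have w_other: "w \<notin> {b, b', c, c'}"
      using only_unique V b c S T by blast
    have dom: "dominates_class G w V"
      using w only_dominates V(1) by blast
    show ?thesis
    proof (cases "w \<in> V")
      case True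
      then have "V = {w}"
        using dom dominates_own by blast
      then show ?thesis by blast
    next
      case False
      then have adj: "w \<rightarrow>\<^bsub>G\<^esub> z" if "z \<in> V" for z
        using that dom dominates_adj by blast
      show ?thesis
      proof (cases "w \<in> T")
        case True
        then have "V \<inter> R = {}"
          using far[OF True] w_other adj adj_sym by blast
        then show ?thesis ..
      next
        case False
        then have "w \<notin> X"
          using w_other unfolding X_def by blast
        then show ?thesis
          using R_step adj class_X[OF V] by blast
      qed
    qed
  qed
  \<comment> \<open>Classes on different sides of \<open>R\<close> have no edge between them,
    against \<open>classes_adjacent\<close>.\<close>
  have same: False if V: "V \<in> C" "V \<noteq> S" "V \<noteq> T" "V \<subseteq> R" and V': "V' \<in> C" "V' \<noteq> S" "V' \<noteq> T" "V' \<inter> R = {}" for V V'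
  proof -
    have "V \<noteq> V'"
      using class_nonempty[OF V(1)] V(4) V'(4) by blast
    then obtain x y where "x \<in> V" "y \<in> V'" "x \<rightarrow>\<^bsub>G\<^esub> y"
      using classes_adjacent V(1) V'(1) by blast
    then show False
      using R_step[of x y] class_X[OF V'(1-3)] V(4) V'(4) by blast
  qed
  obtain V where V: "V \<in> C" "V \<noteq> S" "V \<noteq> T"
    using third_class[OF k] .
  \<comment> \<open>All further classes are on one side. If inside \<open>R\<close>, a vertex
    \<open>v\<close> of \<open>T\<close> dominates one of them, against \<open>far\<close>; if
    outside, \<open>u\<close> dominates one of them and would pull it into \<open>R\<close>.\<close>
  show False
  proof (cases "V \<subseteq> R")
    case True
    have "\<not> T \<subseteq> {b, b'}"
      using large(2) card_mono[of "{b, b'}" T] b(1) by auto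
    then obtain v where v: "v \<in> T" "v \<notin> {b, b'}"
      by blast
    obtain Z where Z: "Z \<in> C" "dominates_class G v Z"
      using dominates_some class_verts[OF T v(1)] by blast
    have "Z \<noteq> S" "Z \<noteq> T"
      using Z K33_S[OF v] not_own[OF T v(1) large(2)] by auto
    then have "Z \<subseteq> R"
      using inside_or_outside[OF Z(1)] same[OF V True Z(1)] by blast
    moreover have "v \<notin> Z"
      using class_unique[OF T Z(1) v(1)] \<open>Z \<noteq> T\<close> by blast
    ultimately show False
      using far[OF v] class_nonempty[OF Z(1)] dominates_adj[OF Z(2)] adj_sym by blast
  next
    case False
    then have out: "V \<inter> R = {}"
      using inside_or_outside V by blast
    obtain Z where Z: "Z \<in> C" "dominates_class G u Z"
      using dominates_some class_verts[OF S u(1)] by blast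
    have ne: "Z \<noteq> S" "Z \<noteq> T"
      using Z K33_T[OF u] not_own[OF S u(1) large(1)] by auto
    then have "Z \<inter> R = {}"
      using inside_or_outside[OF Z(1)] same[OF Z(1) _ _ _ V out] by blast
    moreover have "u \<notin> Z"
      using class_unique[OF S Z(1) u(1)] ne by blast
    ultimately show False
      using R_step[OF u_R] class_X[OF Z(1) ne] class_nonempty[OF Z(1)] dominates_adj[OF Z(2)] by blast
  qed
qed

lemma mutual_pairs:
  assumes k: "3 \<le> card C" and S: "S \<in> C" and T: "T \<in> C" and "S \<noteq> T"
    and ST: "2 \<le> card (only S \<inter> T)" and TS: "2 \<le> card (only T \<inter> S)"
  shows "card S = 2"
proof -
  have "2 \<le> card S" "2 \<le> card T"
    using ST TS card_mono[OF finite_class[OF T], of "only S \<inter> T"]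
      card_mono[OF finite_class[OF S], of "only T \<inter> S"] by auto
  moreover have "\<not> (3 \<le> card S \<and> 3 \<le> card T)"
    using mutual_pairs_not_both_large[OF k S T \<open>S \<noteq> T\<close> ST TS] by blast
  moreover have "card S < 3" if "card T = 2"
    using mutual_pairs_small_side[OF k S T \<open>S \<noteq> T\<close> ST that] .
  ultimately show ?thesis
    by linarith
qed

end

subsection \<open>Cycles of classes\<close>

text \<open>\<open>g\<close> is a choice function for \<open>only_pair\<close>. Two vertices of
  \<open>g S\<close> are adjacent to all of \<open>S\<close>, so a cycle of \<open>g\<close> is a
  closed chain of classes joined in this way.\<close>

locale D_coloring_successor = D_coloring +
  fixes g :: "'a set \<Rightarrow> 'a set"
  assumes g_class: "\<And>S. S \<in> C \<Longrightarrow> g S \<in> C"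
    and g_neq: "\<And>S. S \<in> C \<Longrightarrow> g S \<noteq> S"
    and g_pair: "\<And>S. S \<in> C \<Longrightarrow> 2 \<le> card (only S \<inter> g S)"
begin

lemma pair_adj:
  assumes "S \<in> C" "w \<in> only S \<inter> g S" "v \<in> S"
  shows "w \<rightarrow>\<^bsub>G\<^esub> v" "v \<rightarrow>\<^bsub>G\<^esub> w"
proof -
  have "w \<notin> S"
    using assms class_unique[of S "g S" w] g_class g_neq by auto
  then show "w \<rightarrow>\<^bsub>G\<^esub> v"
    using assms only_dominates dominates_adj by blast
  then show "v \<rightarrow>\<^bsub>G\<^esub> w"
    by (rule adj_sym)
qed

lemma obtain_pair:
  assumes "S \<in> C"
  obtains b b' where "b \<noteq> b'" "b \<in> only S \<inter> g S" "b' \<in> only S \<inter> g S"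
  using g_pair[OF assms] by (auto simp: card_le_Suc_iff numeral_2_eq_2)

lemma no_cycle_3:
  assumes S: "S \<in> C" and cyc: "g (g (g S)) = S"
  shows False
proof -
  define S1 S2 where "S1 = g S" and "S2 = g S1"
  have C: "S1 \<in> C" "S2 \<in> C" and g: "g S = S1" "g S1 = S2" "g S2 = S"
    using S g_class cyc by (auto simp: S1_def S2_def)
  have ne: "S \<noteq> S1" "S1 \<noteq> S2" "S2 \<noteq> S"
    using g g_neq[OF S] g_neq[OF C(1)] g_neq[OF C(2)] by auto
  obtain p p' where p: "p \<noteq> p'" "p \<in> only S \<inter> S1" "p' \<in> only S \<inter> S1"
    using obtain_pair[OF S] g by metis
  obtain q q' where q: "q \<noteq> q'" "q \<in> only S1 \<inter> S2" "q' \<in> only S1 \<inter> S2"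
    using obtain_pair[OF C(1)] g by metis
  obtain r r' where r: "r \<noteq> r'" "r \<in> only S2 \<inter> S" "r' \<in> only S2 \<inter> S"
    using obtain_pair[OF C(2)] g by metis
  have p_adj: "x \<rightarrow>\<^bsub>G\<^esub> y" "y \<rightarrow>\<^bsub>G\<^esub> x" if "x \<in> {p, p'}" "y \<in> S" for x y
    using pair_adj[OF S _ that(2), of x] g p that(1) by auto
  have q_adj: "x \<rightarrow>\<^bsub>G\<^esub> y" "y \<rightarrow>\<^bsub>G\<^esub> x" if "x \<in> {q, q'}" "y \<in> S1" for x y
    using pair_adj[OF C(1) _ that(2), of x] g q that(1) by auto
  have r_adj: "x \<rightarrow>\<^bsub>G\<^esub> y" "y \<rightarrow>\<^bsub>G\<^esub> x" if "x \<in> {r, r'}" "y \<in> S2" for x y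
    using pair_adj[OF C(2) _ that(2), of x] g r that(1) by auto
  have disj: "S \<inter> S1 = {}" "S1 \<inter> S2 = {}" "S \<inter> S2 = {}"
    using class_unique S C ne by blast+
  \<comment> \<open>As \<open>q\<close> dominates only \<open>S1\<close>, it misses some
    \<open>v\<close> in \<open>S\<close>; this \<open>v\<close> differs from \<open>r\<close> and
    \<open>r'\<close>, which are adjacent to all of \<open>S2\<close>, hence to
    \<open>q\<close>.\<close>
  have "\<not> dominates_class G q S"
    using q(2) S ne(1) by (auto simp: only_def)
  then obtain v where v: "v \<in> S" "\<not> q \<rightarrow>\<^bsub>G\<^esub> v"
    by (auto simp: dominates_class_def)
  have v_r: "v \<noteq> r" "v \<noteq> r'"
    using v(2) r_adj(2)[of _ q] q(2) by auto
  \<comment> \<open>The six vertices form an octahedron, and \<open>v\<close> joins its antipodal vertices \<open>p\<close> and \<open>p'\<close>.\<close>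
  show False
  proof (rule no_contracted_K33[of q q' r r' p' "{p, v}" p])
    show "{p, v} \<inter> {q, q', r, r', p'} = {}"
      using p q r v(1) v_r disj by blast
    show "x \<rightarrow>\<^bsub>G\<^esub> y" if "x \<in> {q, q'}" "y \<in> {r, r', p'}" for x y
      using that q_adj(1)[of x p'] r_adj(2)[of r x] r_adj(2)[of r' x] p q by auto
    show "\<exists>u \<in> {p, v}. u \<rightarrow>\<^bsub>G\<^esub> y" if "y \<in> {r, r', p'}" for y
      using that p_adj(1)[of p r] p_adj(1)[of p r'] p_adj(2)[of p' v] r v(1) by auto
    show "(p, u) \<in> {(x, y). x \<in> {p, v} \<and> y \<in> {p, v} \<and> x \<rightarrow>\<^bsub>G\<^esub> y}\<^sup>*" if "u \<in> {p, v}" for u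
      using that p_adj(1)[of p v] v(1) by auto
  qed (use q r p disj in auto)
qed

text \<open>On a cycle of length at least four, the pair \<open>a, a'\<close> is joined to
  \<open>b, b'\<close> and to \<open>q 2\<close>. The rest of the cycle is a path from
  \<open>q 3\<close>, a neighbour of \<open>q 2\<close>, to \<open>q (m - 1)\<close>, a neighbour of
  \<open>b\<close> and \<open>b'\<close>; contracting it gives K_{3,3}.\<close>

lemma cycle_2:
  assumes S: "S \<in> C" and m: "0 < m" "(g ^^ m) S = S" and inj: "inj_on (\<lambda>n. (g ^^ n) S) {..<m}"
  shows "g (g S) = S"
proof -
  define s where "s n = (g ^^ n) S" for n
  have s_C: "s n \<in> C" for n
    unfolding s_def using g_class S by (intro funpow_closed)
  have s_Suc: "g (s n) = s (Suc n)" for n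
    by (simp add: s_def)
  have s_0: "s 0 = S" "s m = S"
    using m by (simp_all add: s_def)
  have "m \<noteq> 1"
  proof
    assume "m = 1"
    then have "g S = S"
      using m(2) by simp
    then show False
      using g_neq[OF S] by blast
  qed
  moreover have "m \<noteq> 3"
  proof
    assume "m = 3"
    then have "g (g (g S)) = S"
      using m(2) by (simp add: numeral_3_eq_3)
    then show False
      using no_cycle_3[OF S] by blast
  qed
  moreover have "\<not> 4 \<le> m"
  proof
    assume m4: "4 \<le> m"
    have s_ne: "s i \<noteq> s j" if "i < m" "j < m" "i \<noteq> j" for i j
      using inj that by (auto simp: inj_on_def s_def)
    have s_disj: "x \<notin> s j" if "x \<in> s i" "s i \<noteq> s j" for i j x
      using class_unique[OF s_C s_C] that by blast
    have adj: "x \<rightarrow>\<^bsub>G\<^esub> y" "y \<rightarrow>\<^bsub>G\<^esub> x" if "x \<in> only (s n) \<inter> s (Suc n)" "y \<in> s n" for x y n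
      using pair_adj[OF s_C[of n] _ that(2), of x] that(1) s_Suc by auto
    obtain a a' where a: "a \<noteq> a'" "a \<in> only (s 1) \<inter> s 2" "a' \<in> only (s 1) \<inter> s 2"
      using obtain_pair[OF s_C[of 1]] s_Suc[of 1] by (metis Suc_1)
    obtain b b' where b: "b \<noteq> b'" "b \<in> only (s 0) \<inter> s 1" "b' \<in> only (s 0) \<inter> s 1"
      using obtain_pair[OF s_C[of 0]] s_Suc[of 0] by (metis One_nat_def)
    have "\<exists>x. x \<in> only (s n) \<inter> s (Suc n)" for n
      using obtain_pair[OF s_C[of n]] s_Suc[of n] by metis
    then obtain q where q: "\<And>n. q n \<in> only (s n) \<inter> s (Suc n)"
      by metis
    have q_s: "q n \<in> s (Suc n)" for n
      using q by blast
    have q_adj: "q n \<rightarrow>\<^bsub>G\<^esub> q (Suc n)" for n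
      using adj(2)[OF q[of "Suc n"] q_s[of n]] .
    define W where "W = q ` {3..<m}"
    have W_s: "x \<notin> s 1 \<and> x \<notin> s 2 \<and> x \<notin> s 3" if x: "x \<in> W" for x
    proof -
      obtain n where "n \<in> {3..<m}" "x = q n"
        using x unfolding W_def by blast
      then have n: "3 \<le> n" "n < m" "x = q n"
        by auto
      \<comment> \<open>\<open>q n\<close> lies one class further, in \<open>s (Suc n)\<close>; for
        \<open>n = m - 1\<close> the index wraps around to \<open>s 0\<close>.\<close>
      have "s (Suc n) \<noteq> s i" if "i \<in> {1, 2, 3}" for i
      proof (cases "Suc n = m")
        case True
        then show ?thesis
          using s_0 s_ne[of 0 i] m4 that by auto
      next
        case False
        then show ?thesis
          using s_ne[of "Suc n" i] n m4 that by auto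
      qed
      then show ?thesis
        using s_disj[OF q_s[of n]] n(3) by auto
    qed
    have s123: "s 1 \<noteq> s 2" "s 1 \<noteq> s 3" "s 2 \<noteq> s 3"
      using s_ne m4 by auto
    show False
    proof (rule no_contracted_K33[of a a' b b' "q 2" W "q 3"])
      show "b \<noteq> q 2" "b' \<noteq> q 2"
        using b(2,3) q_s[of 2] s_disj[of _ 1 3] s123 by (auto simp: numeral_3_eq_3 numeral_2_eq_2)
      show "x \<rightarrow>\<^bsub>G\<^esub> y" if "x \<in> {a, a'}" "y \<in> {b, b', q 2}" for x y
        using that adj(1)[of x 1 b] adj(1)[of x 1 b'] adj(2)[OF q[of 2], of x] a b
        by (auto simp: numeral_2_eq_2)
      show "W \<inter> {a, a', b, b', q 2} = {}"
        using W_s a b q_s[of 2] by (auto simp: numeral_3_eq_3)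
      show "q 3 \<in> W"
        using m4 by (auto simp: W_def)
      show "\<exists>u \<in> W. u \<rightarrow>\<^bsub>G\<^esub> y" if "y \<in> {b, b', q 2}" for y
      proof (cases "y = q 2")
        case True
        then show ?thesis
          using adj_sym[OF q_adj[of 2]] \<open>q 3 \<in> W\<close> by (auto simp: numeral_3_eq_3)
      next
        case False
        have "q (m - 1) \<in> W"
          using m4 by (auto simp: W_def)
        moreover have "q (m - 1) \<in> s 0"
          using q_s[of "m - 1"] s_0 m(1) by simp
        then have "q (m - 1) \<rightarrow>\<^bsub>G\<^esub> y"
          using that False b adj(2)[of y 0 "q (m - 1)"] by auto
        ultimately show ?thesis
          by blast
      qed
      show "(q 3, u) \<in> {(x, y). x \<in> W \<and> y \<in> W \<and> x \<rightarrow>\<^bsub>G\<^esub> y}\<^sup>*" if u: "u \<in> W" for u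
      proof -
        obtain n where "n \<in> {3..<m}" "u = q n"
          using u unfolding W_def by blast
        then have n: "3 \<le> n" "n < m" "u = q n"
          by auto
        have "n < m \<Longrightarrow> (q 3, q n) \<in> {(x, y). x \<in> W \<and> y \<in> W \<and> x \<rightarrow>\<^bsub>G\<^esub> y}\<^sup>*"
          using n(1)
        proof (induction n rule: dec_induct)
          case (step k)
          then have "q k \<in> W" "q (Suc k) \<in> W"
            by (auto simp: W_def)
          then show ?case
            using step.IH step.prems q_adj[of k] by (auto intro: rtrancl_into_rtrancl)
        qed simp
        then show ?thesis
          using n by simp
      qed
    qed (use a b in auto)
  qed
  ultimately have "m = 2"
    using m(1) by linarith
  then show ?thesis
    using m(2) by (simp add: numeral_2_eq_2)
qed

lemma few_colors: "card C < 3"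
proof (rule ccontr)
  assume "\<not> card C < 3"
  then have k: "3 \<le> card C"
    by simp
  have small: "card S = 2" if "S \<in> C" "g (g S) = S" for S
    using mutual_pairs[OF k that(1) g_class[OF that(1)]] g_neq[OF that(1)] g_pair[OF that(1)]
      g_pair[OF g_class[OF that(1)]] that(2) by auto
  define A where "A = {S \<in> C. g (g S) \<noteq> S}"
  \<comment> \<open>If \<open>g S\<close> were on a 2-cycle with \<open>T \<noteq> S\<close>, the
    disjoint sets \<open>only S\<close> and \<open>only T\<close> would each have two vertices in
    \<open>g S\<close>, which has only two elements.\<close>
  have A_closed: "g S \<in> A" if "S \<in> A" for S
  proof (rule ccontr)
    assume "g S \<notin> A"
    define T where "T = g (g S)"
    have S: "S \<in> C" "T \<noteq> S" and gS: "g S \<in> C" and T: "T \<in> C" "g T = g S"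
      using that \<open>g S \<notin> A\<close> g_class by (auto simp: A_def T_def)
    have "card (only S \<inter> g S \<union> only T \<inter> g S) = card (only S \<inter> g S) + card (only T \<inter> g S)"
      using only_unique[OF S(1)] S(2) finite_only by (intro card_Un_disjoint) auto
    moreover have "card (only S \<inter> g S \<union> only T \<inter> g S) \<le> card (g S)"
      using finite_class[OF gS] by (intro card_mono) auto
    moreover have "card (g S) = 2"
      using small[OF gS] T by (simp add: T_def)
    ultimately show False
      using g_pair[OF S(1)] g_pair[OF T(1)] T(2) by simp
  qed
  have "A = {}"
  proof (rule ccontr)
    assume "A \<noteq> {}"
    then obtain S where "S \<in> A" by blast
    moreover have "finite A"
      using finite_C by (simp add: A_def)
    ultimately obtain T m where T: "T \<in> A" "0 < m" "(g ^^ m) T = T" "inj_on (\<lambda>n. (g ^^ n) T) {..<m}"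
      using cycle_in_closed_set[of A S g] A_closed by metis
    then have "g (g T) = T"
      using cycle_2[of T m] by (simp add: A_def)
    then show False
      using T(1) by (simp add: A_def)
  qed
  then have invol: "g (g S) = S" if "S \<in> C" for S
    using that by (auto simp: A_def)
  have pair_eq: "only S \<inter> g S = g S" if "S \<in> C" for S
    using g_pair[OF that] small[OF g_class[OF that]] invol that finite_class[OF g_class[OF that]]
    by (intro card_seteq) (auto simp: g_class)
  obtain S where S: "S \<in> C"
    using k by fastforce
  \<comment> \<open>Every class \<open>U\<close> is contained in \<open>only (g U)\<close>, so the
    sets \<open>only V\<close> partition the vertices just as the classes do.\<close>
  have "only S \<subseteq> g S"
  proof
    fix w assume w: "w \<in> only S"
    then have "w \<in> verts G"
      by (simp add: only_def)
    then obtain U where U: "U \<in> C" "w \<in> U"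
      using class_exists by blast
    then have "w \<in> only (g U)"
      using pair_eq[OF g_class[OF U(1)]] invol by auto
    then have "S = g U"
      using only_unique[OF S w] by blast
    then show "w \<in> g S"
      using invol U by simp
  qed
  then have "only S = g S"
    using pair_eq[OF S] by blast
  moreover have "card (g S) = 2"
    using small[OF g_class[OF S]] invol S g_class by simp
  ultimately show False
    using only_not_pair_class[OF k S g_class[OF S]] g_neq[OF S] by auto
qed

end

section \<open>The case of two colors\<close>

context D_coloring
begin

lemma card_C_less_3: "card C < 3"
proof -
  obtain g where "\<And>S. S \<in> C \<Longrightarrow> g S \<in> C \<and> g S \<noteq> S \<and> 2 \<le> card (only S \<inter> g S)"
    using only_pair by metis
  then interpret D_coloring_successor G p c C g
    by unfold_locales auto
  show ?thesis
    by (rule few_colors)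
qed

lemma card_C_not_1: "card C \<noteq> 1"
proof
  assume "card C = 1"
  then obtain S where S: "C = {S}"
    by (auto simp: card_1_singleton_iff)
  then obtain v where "v \<in> S"
    using class_nonempty by blast
  then obtain u where "v \<rightarrow>\<^bsub>G\<^esub> u"
    using has_neighbour class_verts S by blast
  moreover from this have "u \<in> S"
    using class_exists adj_in_verts(2) S by blast
  ultimately show False
    using class_independent[of S v u] S \<open>v \<in> S\<close> by blast
qed

text \<open>Without singleton classes no vertex dominates its own class, so each is adjacent to all
  of the other class. Excluding K_{3,3} leaves a side of size two.\<close>

lemma complete_bipartite_of_two_colors:
  assumes "card C = 2"
  shows "\<exists>q \<ge> 2. complete_bipartite_digraph 2 q G"
proof -
  obtain S T where C: "C = {S, T}" "S \<noteq> T"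
    using assms by (auto simp: card_2_iff)
  have two: "2 \<le> card V" if V: "V \<in> C" for V
  proof (rule ccontr)
    assume "\<not> ?thesis"
    moreover have "card V \<noteq> 0"
      using class_nonempty[OF V] finite_class[OF V] by simp
    ultimately have "card V = 1"
      by linarith
    then obtain x where x: "V = {x}"
      by (auto simp: card_1_singleton_iff)
    \<comment> \<open>With two classes, a neighbour of a vertex other than \<open>x\<close> lies in
      \<open>V\<close>, hence is \<open>x\<close>; so \<open>x\<close> alone would dominate.\<close>
    have "dominating_set G {x}"
      unfolding dominating_set_def
    proof (intro conjI ballI)
      show "{x} \<subseteq> verts G"
        using class_verts V x by blast
      fix v assume v: "v \<in> verts G - {x}"
      then obtain u where u: "v \<rightarrow>\<^bsub>G\<^esub> u"
        using has_neighbour by blast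
      obtain U U' where U: "U \<in> C" "v \<in> U" "U' \<in> C" "u \<in> U'"
        using class_exists v adj_in_verts(2)[OF u] by blast
      have "U \<noteq> U'"
        using class_independent U u by blast
      moreover have "U \<noteq> V"
        using U v x by blast
      ultimately have "U' = V"
        using U V C by blast
      then show "\<exists>u \<in> {x}. u \<rightarrow>\<^bsub>G\<^esub> v"
        using U x adj_sym[OF u] by blast
    qed
    then show False
      using domination_min[of "{x}"] assms by simp
  qed
  have adj: "u \<rightarrow>\<^bsub>G\<^esub> v" if U: "U \<in> C" "V \<in> C" "U \<noteq> V" "u \<in> U" "v \<in> V" for U V u v
  proof -
    obtain Z where Z: "Z \<in> C" "dominates_class G u Z"
      using dominates_some class_verts U by blast
    have "Z \<noteq> U"
      using dominates_own[OF Z(2)] U(4) two[OF U(1)] by fastforce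
    then have "Z = V"
      using Z(1) U(1-3) C by blast
    moreover have "u \<notin> V"
      using class_unique U by blast
    ultimately show ?thesis
      using dominates_adj Z(2) U(5) by blast
  qed
  have bipartite: "complete_bipartite_digraph (card U) (card V) G" if UV: "C = {U, V}" "U \<noteq> V" for U V
    unfolding complete_bipartite_digraph_def
  proof (intro conjI exI)
    show "graph G"
      by unfold_locales
    show "verts G = U \<union> V"
      using partition UV by (auto simp: partition_on_def)
    show "U \<inter> V = {}"
      using class_unique UV by blast
    show "arcs_ends G = U \<times> V \<union> V \<times> U"
    proof (intro equalityI subrelI)
      fix x y assume xy: "(x, y) \<in> arcs_ends G"
      have "x \<in> U \<union> V" "y \<in> U \<union> V"
        using class_exists[OF adj_in_verts(1)[OF xy]] class_exists[OF adj_in_verts(2)[OF xy]] UV by auto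
      moreover have "\<not> (x \<in> U \<and> y \<in> U)" "\<not> (x \<in> V \<and> y \<in> V)"
        using class_independent[of _ x y] xy UV by blast+
      ultimately show "(x, y) \<in> U \<times> V \<union> V \<times> U"
        by blast
    next
      fix x y assume "(x, y) \<in> U \<times> V \<union> V \<times> U"
      then show "(x, y) \<in> arcs_ends G"
        using adj[of U V x y] adj[of V U x y] UV by auto
    qed
  qed auto
  have "\<not> (3 \<le> card S \<and> 3 \<le> card T)"
    using no_K33[of S T] adj[of S T] C by auto
  then consider "card S = 2" | "card T = 2"
    using two[of S] two[of T] C by force
  then show ?thesis
  proof cases
    case 1
    then show ?thesis
      using bipartite[of S T] C two[of T] by auto
  next
    case 2
    then show ?thesis
      using bipartite[of T S] C two[of S] by auto
  qed
qed

end

section \<open>The numerical invariants and both directions of the equivalence\<close>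

lemma connected_has_neighbour:
  assumes "graph G" "Digraph_Component.connected G" "2 \<le> card (verts G)" "v \<in> verts G"
  shows "\<exists>u. v \<rightarrow>\<^bsub>G\<^esub> u"
proof -
  interpret graph G by fact
  obtain w where w: "w \<in> verts G" "w \<noteq> v"
  proof -
    have "\<not> card (verts G) \<le> Suc 0"
      using assms(3) by simp
    then show thesis
      using that assms(4) card_le_Suc0_iff_eq[OF finite_verts] by blast
  qed
  have "strongly_connected G"
    using symmetric_connected_imp_strongly_connected[OF sym_arcs assms(2)] .
  then have "v \<rightarrow>\<^sup>*\<^bsub>G\<^esub> w"
    using assms(4) w(1) by (auto simp: strongly_connected_def)
  then show ?thesis
    by (cases rule: converse_reachable_cases) (use w in auto)
qed

text \<open>Some dominator coloring exists, so the \<open>LEAST\<close> in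
  \<open>dominator_chromatic_number\<close> is attained.\<close>

lemma singletons_dominator_coloring:
  assumes "graph G"
  shows "dominator_coloring G ((\<lambda>v. {v}) ` verts G)"
proof -
  interpret graph G by fact
  have "partition_on (verts G) ((\<lambda>v. {v}) ` verts G)"
    by (rule partition_onI) auto
  then show ?thesis
    using adj_not_same
    by (auto simp: dominator_coloring_def proper_coloring_def independent_set_def dominates_class_def)
qed

lemma D_graph_coloring:
  assumes "graph G" "D_graph k G"
  obtains C where "dominator_coloring G C" "card C = k"
proof -
  have "\<exists>n C. dominator_coloring G C \<and> card C = n"
    using singletons_dominator_coloring[OF assms(1)] by blast
  then have "\<exists>C. dominator_coloring G C \<and> card C = dominator_chromatic_number G"
    unfolding dominator_chromatic_number_def by (rule LeastI_ex)
  then show thesis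
    using that assms(2) by (auto simp: D_graph_def)
qed

text \<open>The two parts form a dominator coloring, and one vertex from each part dominates. An
  edge forces two colors, and a single vertex misses the other vertices of its own part.\<close>

lemma D_graph_2_complete_bipartite:
  assumes "2 \<le> q" "complete_bipartite_digraph 2 q G"
  shows "D_graph 2 G"
proof -
  obtain U V where UV: "graph G" "verts G = U \<union> V" "U \<inter> V = {}" "card U = 2" "card V = q"
    "arcs_ends G = U \<times> V \<union> V \<times> U"
    using assms(2) unfolding complete_bipartite_digraph_def by blast
  interpret graph G by fact
  have fin: "finite U" "finite V"
    using finite_verts UV(2) by auto
  obtain u u' where u: "U = {u, u'}" "u \<noteq> u'"
    using UV(4) by (auto simp: card_2_iff)
  obtain v v' where v: "v \<in> V" "v' \<in> V" "v \<noteq> v'"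
  proof -
    have "\<not> card V \<le> Suc 0"
      using assms(1) UV(5) by simp
    then show thesis
      using that card_le_Suc0_iff_eq[OF fin(2)] by blast
  qed
  have UV_ne: "U \<noteq> V"
    using UV(3) u by auto
  have coloring: "dominator_coloring G {U, V}"
    unfolding dominator_coloring_def proper_coloring_def partition_on_def independent_set_def
      dominates_class_def disjoint_def
    using UV u(1) v(1) by auto
  have two_colors: "2 \<le> card C" if C: "proper_coloring G C" for C
  proof (rule ccontr)
    assume "\<not> ?thesis"
    moreover have "finite C"
      using C finite_verts unfolding proper_coloring_def by (meson finite_elements)
    moreover have "u \<in> \<Union> C" "v \<in> \<Union> C"
      using C u v UV(2) by (auto simp: proper_coloring_def partition_on_def)
    then obtain S T where ST: "S \<in> C" "u \<in> S" "T \<in> C" "v \<in> T"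
      by blast
    ultimately have "S = T"
      using card_mono[of C "{S, T}"] by (cases "S = T") auto
    moreover have "independent_set G S"
      using C ST(1) by (simp add: proper_coloring_def)
    ultimately show False
      using ST u v UV(6) by (auto simp: independent_set_def)
  qed
  have two_dominators: "2 \<le> card D" if D: "dominating_set G D" for D
  proof (rule ccontr)
    assume "\<not> ?thesis"
    moreover have "finite D"
      using D finite_verts unfolding dominating_set_def by (meson finite_subset)
    ultimately have D_le: "x = y" if "x \<in> D" "y \<in> D" for x y
      using that card_le_Suc0_iff_eq[of D] by auto
    have dom: "\<exists>y \<in> D. y = x \<or> y \<rightarrow>\<^bsub>G\<^esub> x" if "x \<in> U \<union> V" for x
      using D that UV(2) unfolding dominating_set_def by blast
    obtain d where d: "d \<in> D"
      using dom[of u] u by blast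
    have "d = x \<or> d \<rightarrow>\<^bsub>G\<^esub> x" if "x \<in> U \<union> V" for x
      using dom[OF that] D_le[OF d] by blast
    from this[of u] this[of u'] this[of v] this[of v'] show False
      using u v UV(3,6) by auto
  qed
  have dominating: "dominating_set G {u, v}"
    unfolding dominating_set_def using u v UV(2,6) by auto
  have "u \<noteq> v"
    using u v UV(3) by auto
  have card_2: "card {u, v} = 2" "card {U, V} = 2"
    using \<open>u \<noteq> v\<close> UV_ne by simp_all
  have proper: "proper_coloring G X" if "dominator_coloring G X" for X
    using that by (simp add: dominator_coloring_def)
  have "domination_number G = 2"
    unfolding domination_number_def
    by (intro Least_equality) (use dominating card_2 two_dominators in blast)+
  moreover have "chromatic_number G = 2"
    unfolding chromatic_number_def
    by (intro Least_equality) (use proper[OF coloring] card_2 two_colors in blast)+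
  moreover have "dominator_chromatic_number G = 2"
    unfolding dominator_chromatic_number_def
    by (intro Least_equality) (use coloring proper card_2 two_colors in blast)+
  ultimately show ?thesis
    by (simp add: D_graph_def)
qed

theorem theorem5:
  fixes G :: "('a, 'b) pre_digraph" and k :: nat
  assumes "graph G"
    and "Digraph_Component.connected G"
    and "card (verts G) \<ge> 2"
    and "planar G"
    and "k > 0"
  shows "D_graph k G \<longleftrightarrow> k = 2 \<and> (\<exists>q \<ge> 2. complete_bipartite_digraph 2 q G)"
proof
  assume D: "D_graph k G"
  obtain C where C: "dominator_coloring G C" "card C = k"
    using D_graph_coloring[OF assms(1) D] .
  obtain p c where pc: "plane_drawing G p c"
    using assms(4) by (auto simp: planar_def)
  have "domination_number G \<le> card X" if "dominating_set G X" for X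
    unfolding domination_number_def using that by (intro Least_le) blast
  moreover have "chromatic_number G \<le> card X" if "proper_coloring G X" for X
    unfolding chromatic_number_def using that by (intro Least_le) blast
  moreover have "domination_number G = k" "chromatic_number G = k"
    using D by (simp_all add: D_graph_def)
  \<comment> \<open>Both minimality assumptions hold because \<open>card C = k\<close> equals the
    two invariants.\<close>
  ultimately interpret D_coloring G p c C
    using assms(1) pc C connected_has_neighbour[OF assms(1-3)]
    by (intro D_coloring.intro drawn_graph.intro drawn_graph_axioms.intro D_coloring_axioms.intro) auto
  have "k = 2"
    using card_C_less_3 card_C_not_1 C(2) assms(5) by auto
  then show "k = 2 \<and> (\<exists>q \<ge> 2. complete_bipartite_digraph 2 q G)"
    using complete_bipartite_of_two_colors C(2) by simp
next
  assume "k = 2 \<and> (\<exists>q \<ge> 2. complete_bipartite_digraph 2 q G)"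
  then show "D_graph k G"
    using D_graph_2_complete_bipartite by blast
qed

end
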